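(* The clique number of the 1-skeleton of the polytope $\operatorname{PSB}(n)$ satisfies $\omega(\operatorname{PSB}(n))=\Theta(n^2)$; that is, there exist constants $c_1,c_2>0$ and $n_0$ such that $c_1 n^2\le \omega(\operatorname{PSB}(n))\le c_2 n^2$ for all $n\ge n_0$.
   Context: Let $K_n=(V,E)$ be the complete directed graph on the vertex set $V=\{1,\dots,n\}$ (cities), with arc set $E$ consisting of all ordered pairs $(u,v)$, $u\neq v$. A Hamiltonian tour $\tau$ is a directed cycle through all cities; $\tau(i)$ denotes the successor of city $i$, $\tau^{-1}(i)$ its predecessor, and $\tau^{k}(i)$, $\tau^{-k}(i)$ the $k$-th successor and $k$-th predecessor. A city $i$ is a peak if $\tau^{-1}(i)<i$ and $\tau(i)<i$. A city $i$ is a step-back peak if either ($\tau^{-1}(i)<i$, $\tau(i)=i-1$, $\tau^2(i)>i$) or ($\tau^{-2}(i)>i$, $\tau^{-1}(i)=i-1$, $\tau(i)<i$). A proper peak is a peak that is not a step-back peak. A pyramidal tour with step-backs is a Hamiltonian tour whose only proper peak is $n$. For a tour $x$, its characteristic vector $\mathbf{v}(x)\in\mathbb{R}^{E}$ has $\mathbf{v}(x)_e=1$ if the arc $e$ is used by $x$ and $0$ otherwise. The polytope of pyramidal tours with step-backs is $\operatorname{PSB}(n)=\operatorname{conv}\{\mathbf{v}(x) : x \text{ is a pyramidal tour with step-backs in } K_n\}$. The 1-skeleton of a polytope is the graph whose vertices are the vertices of the polytope and whose edges are the one-dimensional faces (geometric edges) of the polytope. $\omega(\operatorname{PSB}(n))$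 denotes the clique number of this 1-skeleton, i.e. the maximum number of pairwise adjacent vertices of $\operatorname{PSB}(n)$. *)

theory Defs
  imports "HOL-Analysis.Analysis" "HOL-Analysis.Finite_Function_Topology"
    "HOL-Combinatorics.Combinatorics"
begin

section \<open>The 1-skeleton of a polytope and its clique number\<close>

text \<open>
  The library's \<open>aff_dim\<close> and \<open>edge_of\<close> require a Euclidean space, whose dimension is fixed by the
  type. Here the dimension depends on a number, so both notions are restated for an arbitrary
  real vector space; \<open>has_aff_dim_iff\<close> and \<open>is_edge_of_iff\<close> below show that they agree with the
  library's notions on Euclidean spaces.
\<close>

definition has_aff_dim :: "'a::real_vector set \<Rightarrow> nat \<Rightarrow> bool" where
  "has_aff_dim S d \<longleftrightarrow>
     (\<exists>B. affine hull B = affine hull S \<and> \<not> affine_dependent B \<and> card B = d + 1)"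

definition is_edge_of :: "'a::real_vector set \<Rightarrow> 'a set \<Rightarrow> bool" where
  "is_edge_of F P \<longleftrightarrow> F face_of P \<and> has_aff_dim F 1"

definition vertices :: "'a::real_vector set \<Rightarrow> 'a set" where
  "vertices P = {x. x extreme_point_of P}"

definition adjacent :: "'a::real_vector set \<Rightarrow> 'a \<Rightarrow> 'a \<Rightarrow> bool" where
  "adjacent P x y \<longleftrightarrow>
     x \<in> vertices P \<and> y \<in> vertices P \<and> x \<noteq> y \<and> (\<exists>F. is_edge_of F P \<and> x \<in> F \<and> y \<in> F)"

text \<open>
  \<open>Max\<close> is meaningful only if there are finitely many vertices; see \<open>finite_vertices_PSB\<close>.
\<close>

definition clique_number :: "'a::real_vector set \<Rightarrow> nat" where
  "clique_number P = Max (card ` {C. C \<subseteq> vertices P \<and> pairwise (adjacent P) C})"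

lemma has_aff_dim_iff:
  fixes S :: "'a::euclidean_space set"
  shows "has_aff_dim S d \<longleftrightarrow> aff_dim S = int d"
proof
  assume "has_aff_dim S d"
  then obtain B where B: "affine hull B = affine hull S" "\<not> affine_dependent B" "card B = d + 1"
    by (auto simp: has_aff_dim_def)
  then have "int (card B) = aff_dim S + 1"
    using aff_dim_unique[of B S] by simp
  with B show "aff_dim S = int d" by simp
next
  assume "aff_dim S = int d"
  moreover obtain B where "affine hull B = affine hull S" "\<not> affine_dependent B"
      "int (card B) = aff_dim S + 1"
    using aff_dim_basis_exists[of S] by auto
  ultimately show "has_aff_dim S d"
    unfolding has_aff_dim_def by (intro exI[of _ B]) simp
qed

lemma is_edge_of_iff:
  fixes P :: "'a::euclidean_space set"
  shows "is_edge_of F P \<longleftrightarrow> F edge_of P"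
  by (simp add: is_edge_of_def edge_of_def has_aff_dim_iff)


section \<open>Pyramidal tours with step-backs\<close>

text \<open>
  A Hamiltonian tour is represented by its successor function \<open>\<tau>\<close>, a cyclic permutation of the
  cities that is the identity elsewhere, so that distinct functions are distinct tours.
\<close>

definition hamiltonian_tour :: "nat \<Rightarrow> (nat \<Rightarrow> nat) \<Rightarrow> bool" where
  "hamiltonian_tour n \<tau> \<longleftrightarrow> \<tau> permutes {1..n} \<and> cyclic_on \<tau> {1..n}"

definition peak :: "(nat \<Rightarrow> nat) \<Rightarrow> nat \<Rightarrow> bool" where
  "peak \<tau> i \<longleftrightarrow> inv \<tau> i < i \<and> \<tau> i < i"

text \<open>Cities are at least 1, so the subtraction below is not truncated.\<close>

definition step_back_peak :: "(nat \<Rightarrow> nat) \<Rightarrow> nat \<Rightarrow> bool" where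
  "step_back_peak \<tau> i \<longleftrightarrow>
     (inv \<tau> i < i \<and> \<tau> i = i - 1 \<and> (\<tau> ^^ 2) i > i) \<or>
     ((inv \<tau> ^^ 2) i > i \<and> inv \<tau> i = i - 1 \<and> \<tau> i < i)"

definition proper_peak :: "(nat \<Rightarrow> nat) \<Rightarrow> nat \<Rightarrow> bool" where
  "proper_peak \<tau> i \<longleftrightarrow> peak \<tau> i \<and> \<not> step_back_peak \<tau> i"

definition psb_tour :: "nat \<Rightarrow> (nat \<Rightarrow> nat) \<Rightarrow> bool" where
  "psb_tour n \<tau> \<longleftrightarrow> hamiltonian_tour n \<tau> \<and> {i \<in> {1..n}. proper_peak \<tau> i} = {n}"


section \<open>The polytope\<close>

definition arcs :: "nat \<Rightarrow> (nat \<times> nat) set" where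
  "arcs n = {(u, v). u \<in> {1..n} \<and> v \<in> {1..n} \<and> u \<noteq> v}"

text \<open>
  The space of real vectors indexed by \<open>arcs n\<close> is taken as the subspace of those finitely
  supported functions on \<open>nat \<times> nat\<close> that vanish outside \<open>arcs n\<close>. This way a single type serves
  all \<open>n\<close>; the faces of a polytope do not depend on the ambient space.
\<close>

definition char_vec :: "nat \<Rightarrow> (nat \<Rightarrow> nat) \<Rightarrow> (nat \<times> nat) \<Rightarrow>\<^sub>0 real" where
  "char_vec n \<tau> = (\<Sum>e \<in> {(u, v) \<in> arcs n. \<tau> u = v}. Poly_Mapping.single e 1)"

definition PSB :: "nat \<Rightarrow> ((nat \<times> nat) \<Rightarrow>\<^sub>0 real) set" where
  "PSB n = convex hull (char_vec n ` {\<tau>. psb_tour n \<tau>})"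

lemma finite_arcs: "finite (arcs n)"
  by (rule finite_subset[of _ "{1..n} \<times> {1..n}"]) (auto simp: arcs_def)

lemma lookup_char_vec:
  "Poly_Mapping.lookup (char_vec n \<tau>) (u, v) = (if (u, v) \<in> arcs n \<and> \<tau> u = v then 1 else 0)"
proof -
  have "finite {(u, v) \<in> arcs n. \<tau> u = v}"
    by (rule finite_subset[OF _ finite_arcs[of n]]) auto
  then show ?thesis
    by (simp add: char_vec_def lookup_sum lookup_single when_def sum.delta)
qed

lemma finite_vertices_PSB: "finite (vertices (PSB n))"
proof -
  have "finite {\<tau>. psb_tour n \<tau>}"
    by (rule finite_subset[OF _ finite_permutations[of "{1..n}"]])
       (auto simp: psb_tour_def hamiltonian_tour_def)
  moreover have "vertices (PSB n) \<subseteq> char_vec n ` {\<tau>. psb_tour n \<tau>}"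
    using extreme_point_of_convex_hull by (auto simp: vertices_def PSB_def)
  ultimately show ?thesis
    by (metis finite_imageI finite_subset)
qed

end

theory Submission
  imports Defs
begin

text \<open>
  Upper bound: if two tours cross \<open>{1..i}\<close> with a single leaving arc from \<open>a\<close> and a single entering
  arc at \<open>d\<close>, for the same \<open>a\<close> and \<open>d\<close>, then exchanging their parts on \<open>{1..i}\<close> gives two tours
  with the same midpoint. So the members of a clique that share the state \<open>(i, a, d)\<close> all agree below
  it or all agree above it. The first holds at the start of a tour and the second at its end,
  so each tour has two consecutive states where the first kind changes to the second, and these
  determine the tour. A tour passes from one state to the next in one of four ways, and
  \<open>a\<close> or \<open>d\<close> lies in \<open>{i - 1, i}\<close>, so there are only \<open>O(n\<^sup>2)\<close> such pairs of states.

  Lower bound: the tours ascending along \<open>1, s, t, n\<close> with \<open>s\<close>, \<open>t\<close> even and \<open>s < n / 2 < t\<close>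
  (roughly) are pairwise adjacent, since the union of two of them contains no third permutation.
\<close>

section \<open>Tours and cuts\<close>

lemma hamiltonian_tour_bij: "hamiltonian_tour n \<tau> \<Longrightarrow> bij \<tau>"
  by (auto simp: hamiltonian_tour_def permutes_bij)

lemma hamiltonian_tour_in: "hamiltonian_tour n \<tau> \<Longrightarrow> u \<in> {1..n} \<Longrightarrow> \<tau> u \<in> {1..n}"
  using permutes_in_image[of \<tau> "{1..n}" u] by (simp add: hamiltonian_tour_def)

lemma hamiltonian_tour_out: "hamiltonian_tour n \<tau> \<Longrightarrow> u \<notin> {1..n} \<Longrightarrow> \<tau> u = u"
  by (auto simp: hamiltonian_tour_def permutes_def)

lemma hamiltonian_tour_funpow_in:
  "hamiltonian_tour n \<tau> \<Longrightarrow> u \<in> {1..n} \<Longrightarrow> (\<tau> ^^ k) u \<in> {1..n}"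
  using cyclic_on_funpow_in[of \<tau> "{1..n}" u k] by (simp add: hamiltonian_tour_def)

lemma hamiltonian_tour_reach:
  assumes "hamiltonian_tour n \<tau>" "u \<in> {1..n}" "v \<in> {1..n}"
  obtains k where "(\<tau> ^^ k) u = v"
proof -
  have "v \<in> orbit \<tau> u"
    using assms unfolding hamiltonian_tour_def cyclic_on_alldef by blast
  then show ?thesis
    using that by (auto simp: orbit_altdef)
qed

lemma hamiltonian_tour_closed:
  assumes "hamiltonian_tour n \<tau>" "u \<in> A" "u \<in> {1..n}" "\<And>v. v \<in> A \<Longrightarrow> \<tau> v \<in> A"
  shows "{1..n} \<subseteq> A"
proof
  fix v assume "v \<in> {1..n}"
  then obtain k where "(\<tau> ^^ k) u = v"
    using hamiltonian_tour_reach assms by metis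
  moreover have "(\<tau> ^^ k) u \<in> A"
    by (induction k) (use assms in auto)
  ultimately show "v \<in> A" by simp
qed

lemma hamiltonian_tourI:
  assumes "\<tau> permutes {1..n}" "s \<in> {1..n}" "\<And>u. u \<in> {1..n} \<Longrightarrow> \<exists>k. (\<tau> ^^ k) s = u"
  shows "hamiltonian_tour n \<tau>"
proof -
  have "permutation \<tau>"
    using assms(1) permutation_permutes by blast
  then have eq: "orbit \<tau> s = {(\<tau> ^^ k) s | k. True}"
    by (rule orbit_altdef_permutation)
  have "(\<tau> ^^ k) s \<in> {1..n}" for k
    by (induction k) (use assms(1,2) permutes_in_image[OF assms(1)] in auto)
  with assms(3) have "{1..n} = {(\<tau> ^^ k) s | k. True}"
    by (auto simp del: atLeastAtMost_iff)
  with eq have "{1..n} = orbit \<tau> s"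
    by simp
  with assms(1,2) show ?thesis
    unfolding hamiltonian_tour_def cyclic_on_def by metis
qed

lemma hamiltonian_tour_inv:
  assumes "hamiltonian_tour n \<tau>"
  shows "hamiltonian_tour n (inv \<tau>)"
proof -
  have "permutation \<tau>"
    using assms permutation_permutes unfolding hamiltonian_tour_def by blast
  then show ?thesis
    using assms permutes_inv unfolding hamiltonian_tour_def cyclic_on_def
    by (auto simp: orbit_inv_eq)
qed

lemma hamiltonian_tour_no_fixpoint:
  assumes "hamiltonian_tour n \<tau>" "2 \<le> n" "u \<in> {1..n}"
  shows "\<tau> u \<noteq> u"
proof
  assume "\<tau> u = u"
  then have "{1..n} \<subseteq> {u}"
    by (intro hamiltonian_tour_closed[OF assms(1), of u]) (use assms in auto)
  then have "card {1..n} \<le> card {u}"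
    by (intro card_mono) auto
  with assms show False by simp
qed

lemma psb_tour_hamiltonian: "psb_tour n \<tau> \<Longrightarrow> hamiltonian_tour n \<tau>"
  by (simp add: psb_tour_def)

lemma psb_tour_iff:
  assumes "1 \<le> n"
  shows "psb_tour n \<tau> \<longleftrightarrow> hamiltonian_tour n \<tau> \<and> (\<forall>u \<in> {1..n}. proper_peak \<tau> u \<longleftrightarrow> u = n)"
proof -
  have "{i \<in> {1..n}. proper_peak \<tau> i} = {n} \<longleftrightarrow> (\<forall>u \<in> {1..n}. proper_peak \<tau> u \<longleftrightarrow> u = n)"
    using assms by fastforce
  then show ?thesis by (simp add: psb_tour_def)
qed

text \<open>Reversing a tour exchanges the two disjuncts of \<open>step_back_peak\<close>, so
  whatever is shown for pyramidal tours in one direction holds in the other as well.\<close>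

lemma proper_peak_inv: "bij \<tau> \<Longrightarrow> proper_peak (inv \<tau>) = proper_peak \<tau>"
  by (auto simp: fun_eq_iff proper_peak_def peak_def step_back_peak_def inv_inv_eq)

lemma psb_tour_inv: "psb_tour n \<tau> \<Longrightarrow> psb_tour n (inv \<tau>)"
  by (metis psb_tour_def hamiltonian_tour_bij hamiltonian_tour_inv proper_peak_inv)


text \<open>Exactly one arc of the tour leaves \<open>{1..i}\<close>, from \<open>a\<close>, and exactly one enters it, at \<open>d\<close>.\<close>

definition cut :: "(nat \<Rightarrow> nat) \<Rightarrow> nat \<Rightarrow> nat \<Rightarrow> nat \<Rightarrow> bool" where
  "cut \<tau> i a d \<longleftrightarrow> a \<in> {1..i} \<and> d \<in> {1..i} \<and> i < \<tau> a \<and> i < inv \<tau> d \<and>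
     (\<forall>u \<in> {1..i} - {a}. \<tau> u \<le> i) \<and> (\<forall>u \<in> {1..i} - {d}. inv \<tau> u \<le> i)"

section \<open>Splicing two tours along a common cut\<close>

definition splice :: "nat \<Rightarrow> nat \<Rightarrow> (nat \<Rightarrow> nat) \<Rightarrow> (nat \<Rightarrow> nat) \<Rightarrow> nat \<Rightarrow> nat" where
  "splice i a x y u = (if u \<in> {1..i} - {a} then x u else y u)"

lemma cut_inv: "bij \<tau> \<Longrightarrow> cut \<tau> i a d \<Longrightarrow> cut (inv \<tau>) i d a"
  by (auto simp: cut_def inv_inv_eq)

text \<open>Together with \<open>cut_outside\<close>, this makes \<open>x\<close> a bijection from
  \<open>{1..i} - {a}\<close> onto \<open>{1..i} - {d}\<close> and between the complements. Sets and
  images depend only on the cut, so such pieces of two tours can be exchanged; the arc at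
  \<open>a\<close> leaves \<open>{1..i}\<close> and therefore belongs to the outer piece of
  \<open>splice\<close>.\<close>

lemma cut_inside:
  assumes "hamiltonian_tour n x" "i \<le> n" "cut x i a d" "u \<in> {1..i} - {a}"
  shows "x u \<in> {1..i} - {d}"
proof -
  have "inv x (x u) = u"
    using hamiltonian_tour_bij[OF assms(1)] by (simp add: bij_is_inj)
  moreover have "x u \<in> {1..n}"
    using hamiltonian_tour_in[OF assms(1), of u] assms by auto
  ultimately show ?thesis
    using assms by (auto simp: cut_def)
qed

lemma cut_outside:
  assumes "hamiltonian_tour n x" "i \<le> n" "cut x i a d" "u \<notin> {1..i} - {a}"
  shows "x u \<notin> {1..i} - {d}"
proof
  assume xu: "x u \<in> {1..i} - {d}"
  have b: "bij x" using assms(1) by (rule hamiltonian_tour_bij)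
  have "inv x (x u) \<in> {1..i} - {a}"
    using cut_inside[OF hamiltonian_tour_inv[OF assms(1)] assms(2) cut_inv[OF b assms(3)] xu] .
  with assms(4) b show False by (simp add: bij_is_inj)
qed

lemma splice_splice:
  assumes "hamiltonian_tour n x" "hamiltonian_tour n y" "i \<le> n" "cut x i a d" "cut y i a d"
  shows "splice i d (inv x) (inv y) (splice i a x y u) = u"
proof -
  have "inv x (x u) = u" "inv y (y u) = u"
    using assms hamiltonian_tour_bij bij_is_inj inv_f_f by metis+
  then show ?thesis
    using cut_inside[OF assms(1,3,4), of u] cut_outside[OF assms(2,3,5), of u]
    by (cases "u \<in> {1..i} - {a}") (simp_all only: splice_def if_True if_False not_False_eq_True)
qed

lemma splice_splice':
  assumes "hamiltonian_tour n x" "hamiltonian_tour n y" "i \<le> n" "cut x i a d" "cut y i a d"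
  shows "splice i a x y (splice i d (inv x) (inv y) u) = u"
proof -
  have b: "bij x" "bij y" using assms hamiltonian_tour_bij by auto
  have "splice i a (inv (inv x)) (inv (inv y)) (splice i d (inv x) (inv y) u) = u"
    by (intro splice_splice[of n] hamiltonian_tour_inv cut_inv assms b)
  then show ?thesis by (simp add: inv_inv_eq b)
qed

lemma splice_bij:
  assumes "hamiltonian_tour n x" "hamiltonian_tour n y" "i \<le> n" "cut x i a d" "cut y i a d"
  shows "bij (splice i a x y)"
  by (rule o_bij[of "splice i d (inv x) (inv y)"])
     (use splice_splice[OF assms] splice_splice'[OF assms] in \<open>auto simp: fun_eq_iff\<close>)

lemma inv_splice:
  assumes "hamiltonian_tour n x" "hamiltonian_tour n y" "i \<le> n" "cut x i a d" "cut y i a d"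
  shows "inv (splice i a x y) = splice i d (inv x) (inv y)"
  by (rule inv_unique_comp)
     (use splice_splice[OF assms] splice_splice'[OF assms] in \<open>auto simp: fun_eq_iff\<close>)

text \<open>Inside the cut each tour runs along one path from \<open>d\<close> to \<open>a\<close>
  through all of \<open>{1..i}\<close>, and outside along one path from \<open>a\<close> back to
  \<open>d\<close>. The inner path of \<open>x\<close> and the outer path of \<open>y\<close> close
  up to a single cycle.\<close>

lemma hamiltonian_tour_splice:
  assumes "hamiltonian_tour n x" "hamiltonian_tour n y" "i \<le> n" "cut x i a d" "cut y i a d"
  shows "hamiltonian_tour n (splice i a x y)"
proof (rule hamiltonian_tourI)
  let ?z = "splice i a x y"
  have ad: "a \<in> {1..i}" "d \<in> {1..i}" "a \<in> {1..n}" "d \<in> {1..n}"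
    using assms(3,4) by (auto simp: cut_def)
  show "?z permutes {1..n}"
  proof (rule bij_imp_permutes)
    show "?z u = u" if "u \<notin> {1..n}" for u
      using that assms(3) hamiltonian_tour_out[OF assms(2) that] by (auto simp: splice_def)
    have "?z ` {1..n} \<subseteq> {1..n}"
      using hamiltonian_tour_in[OF assms(1)] hamiltonian_tour_in[OF assms(2)]
      unfolding splice_def by auto
    moreover have "inj_on ?z {1..n}"
      using splice_bij[OF assms] by (meson bij_is_inj inj_on_subset subset_UNIV)
    ultimately show "bij_betw ?z {1..n} {1..n}"
      by (simp add: bij_betw_def endo_inj_surj)
  qed
  show "d \<in> {1..n}" by fact
  define R where "R = {u. \<exists>k. (?z ^^ k) d = u}"
  have R0: "d \<in> R" unfolding R_def by (auto intro: exI[of _ 0])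
  have RS: "?z u \<in> R" if "u \<in> R" for u
    using that unfolding R_def by (auto intro: exI[of _ "Suc k" for k])
  \<comment> \<open>The orbit of \<open>d\<close> under \<open>x\<close> follows the splice while it
    is inside and before \<open>a\<close>; it can re-enter \<open>{1..i}\<close> only at
    \<open>d\<close>, which is in \<open>R\<close> from the start.\<close>
  have low: "(x ^^ k) d \<le> i \<Longrightarrow> (x ^^ k) d \<in> R" for k
  proof (induction k)
    case (Suc k)
    let ?w = "(x ^^ k) d"
    have w: "?w \<in> {1..n}" using hamiltonian_tour_funpow_in[OF assms(1) ad(4)] .
    show ?case
    proof (cases "?w \<in> {1..i} - {a}")
      case True
      with Suc have "?z ?w \<in> R" by (intro RS) auto
      with True show ?thesis by (simp add: splice_def)
    next
      case False
      from cut_outside[OF assms(1,3,4) False] have "x ?w \<notin> {1..i} - {d}" .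
      moreover have "x ?w \<in> {1..n}" using hamiltonian_tour_in[OF assms(1) w] .
      ultimately have "x ?w = d" using Suc.prems by auto
      then show ?thesis using R0 by simp
    qed
  qed (use R0 in simp)
  have lowR: "{1..i} \<subseteq> R"
  proof
    fix u assume u: "u \<in> {1..i}"
    then have "u \<in> {1..n}" using assms(3) by auto
    then obtain k where "(x ^^ k) d = u"
      using hamiltonian_tour_reach[OF assms(1) ad(4)] by metis
    then show "u \<in> R" using low[of k] u by auto
  qed
  \<comment> \<open>Inside the cut everything is reached already by \<open>lowR\<close>, and
    elsewhere the splice moves as \<open>y\<close> does.\<close>
  have high: "(y ^^ k) a \<in> R" for k
  proof (induction k)
    case 0
    then show ?case using lowR ad by auto
  next
    case (Suc k)
    let ?w = "(y ^^ k) a"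
    show ?case
    proof (cases "?w \<in> {1..i} - {a}")
      case True
      then show ?thesis
        using cut_inside[OF assms(2,3,5) True] lowR by auto
    next
      case False
      have "?z ?w \<in> R" by (rule RS) fact
      moreover have "?z ?w = y ?w"
        using False unfolding splice_def by (rule if_not_P)
      ultimately show ?thesis by simp
    qed
  qed
  show "\<exists>k. (?z ^^ k) d = u" if u: "u \<in> {1..n}" for u
  proof -
    obtain k where "(y ^^ k) a = u"
      using hamiltonian_tour_reach[OF assms(2) ad(3) u] .
    with high[of k] show ?thesis by (simp add: R_def)
  qed
qed

text \<open>
  Whether \<open>u\<close> is a proper peak only depends on the two neighbours of \<open>u\<close> on either side, and for
  a neighbour beyond the cut it only matters on which side of the cut it lies.
\<close>

lemma proper_peak_splice_low:
  assumes "hamiltonian_tour n x" "hamiltonian_tour n y" "i \<le> n" "cut x i a d" "cut y i a d"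
    and u: "u \<in> {1..i}"
  shows "proper_peak (splice i a x y) u \<longleftrightarrow> proper_peak x u"
proof -
  define z w where "z = splice i a x y" and "w = splice i d (inv x) (inv y)"
  have w: "inv z = w" using inv_splice[OF assms(1-5)] by (simp add: z_def w_def)
  have z1: "z v = x v \<or> i < z v \<and> i < x v" if "v \<in> {1..i}" for v
    using that assms(4,5) by (auto simp: z_def splice_def cut_def)
  have w1: "w v = inv x v \<or> i < w v \<and> i < inv x v" if "v \<in> {1..i}" for v
    using that assms(4,5) by (auto simp: w_def splice_def cut_def)
  have un: "u \<in> {1..n}" using u assms(3) by auto
  have pos: "0 < x u" "0 < inv x u"
    using hamiltonian_tour_in[OF assms(1) un]
      hamiltonian_tour_in[OF hamiltonian_tour_inv[OF assms(1)] un] by auto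
  \<comment> \<open>The second neighbour matters only if the first one is below \<open>u\<close>;
    the first one is then inside the cut, where \<open>z1\<close> applies again.\<close>
  have z2: "z (z u) > u \<longleftrightarrow> x (x u) > u" if "z u < u"
    using that z1[OF u] z1[of "x u"] u pos by auto
  have w2: "w (w u) > u \<longleftrightarrow> inv x (inv x u) > u" if "w u < u"
    using that w1[OF u] w1[of "inv x u"] u pos by auto
  have z3: "z u < u \<longleftrightarrow> x u < u" "z u < u \<Longrightarrow> z u = x u"
    using z1[OF u] u by auto
  have w3: "w u < u \<longleftrightarrow> inv x u < u" "w u < u \<Longrightarrow> w u = inv x u"
    using w1[OF u] u by auto
  show ?thesis
  proof (cases "z u < u \<and> w u < u")
    case True
    then have zw: "z u < u" "w u < u"
      by simp_all
    have e: "z u = x u" "w u = inv x u"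
      by (rule z3(2)[OF zw(1)], rule w3(2)[OF zw(2)])
    have e2: "(u < z (x u)) = (u < x (x u))" "(u < w (inv x u)) = (u < inv x (inv x u))"
      using z2[OF zw(1)] w2[OF zw(2)] unfolding e by blast+
    show ?thesis
      unfolding z_def[symmetric] proper_peak_def peak_def step_back_peak_def w
        numeral_2_eq_2 funpow.simps comp_apply id_apply e e2 ..
  next
    case False
    then have "\<not> (x u < u \<and> inv x u < u)"
      using z3(1) w3(1) by blast
    with False show ?thesis
      unfolding z_def[symmetric] proper_peak_def peak_def w by blast
  qed
qed

lemma proper_peak_splice_high:
  assumes "hamiltonian_tour n x" "hamiltonian_tour n y" "i \<le> n" "cut x i a d" "cut y i a d"
    and u: "i < u"
  shows "proper_peak (splice i a x y) u \<longleftrightarrow> proper_peak y u"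
proof -
  define z w where "z = splice i a x y" and "w = splice i d (inv x) (inv y)"
  have w: "inv z = w" using inv_splice[OF assms(1-5)] by (simp add: z_def w_def)
  have z1: "z v = y v \<or> z v \<le> i \<and> y v \<le> i" for v
    using assms(4,5) by (auto simp: z_def splice_def cut_def)
  have w1: "w v = inv y v \<or> w v \<le> i \<and> inv y v \<le> i" for v
    using assms(4,5) by (auto simp: w_def splice_def cut_def)
  have z2: "z u = y u" and w2: "w u = inv y u"
    using u by (auto simp: z_def w_def splice_def)
  have z3: "z v > u \<longleftrightarrow> y v > u" and w3: "w v > u \<longleftrightarrow> inv y v > u" for v
    using z1[of v] w1[of v] u by auto
  show ?thesis
    unfolding z_def[symmetric] proper_peak_def peak_def step_back_peak_def w
    by (simp add: numeral_2_eq_2 z2 z3 w2 w3)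
qed

text \<open>Each city inherits its proper-peak status from the tour governing its side of the cut;
  \<open>n\<close> is on the upper side because \<open>i < n\<close>.\<close>

lemma psb_tour_splice:
  assumes "psb_tour n x" "psb_tour n y" "i < n" "cut x i a d" "cut y i a d"
  shows "psb_tour n (splice i a x y)"
proof -
  note h = psb_tour_hamiltonian[OF assms(1)] psb_tour_hamiltonian[OF assms(2)]
    less_imp_le[OF assms(3)] assms(4,5)
  have n: "1 \<le> n" using assms(3) by simp
  have "proper_peak (splice i a x y) u \<longleftrightarrow> u = n" if u: "u \<in> {1..n}" for u
  proof (cases "u \<le> i")
    case True
    then have "proper_peak (splice i a x y) u \<longleftrightarrow> proper_peak x u"
      using u by (intro proper_peak_splice_low[OF h]) simp
    with u assms(1) n show ?thesis by (simp add: psb_tour_iff)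
  next
    case False
    then have "proper_peak (splice i a x y) u \<longleftrightarrow> proper_peak y u"
      by (intro proper_peak_splice_high[OF h]) simp
    with u assms(2) n show ?thesis by (simp add: psb_tour_iff)
  qed
  with hamiltonian_tour_splice[OF h] n show ?thesis by (simp add: psb_tour_iff)
qed

section \<open>Consecutive cuts of a pyramidal tour\<close>

lemma hamiltonian_tour_arc_in:
  assumes "hamiltonian_tour n x" "i \<le> n" "cut x i a d" "i < u" "x u \<le> i"
  shows "x u = d"
proof -
  have "u \<notin> {1..i} - {a}" using assms(4) by auto
  from cut_outside[OF assms(1-3) this] have "x u \<notin> {1..i} - {d}" .
  moreover have "x u \<in> {1..n}"
  proof (rule hamiltonian_tour_in[OF assms(1)])
    show "u \<in> {1..n}"
      using hamiltonian_tour_out[OF assms(1), of u] assms(4,5) by (cases "u \<le> n") auto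
  qed
  ultimately show ?thesis using assms(5) by auto
qed

lemma hamiltonian_tour_arc_out:
  assumes "hamiltonian_tour n x" "i \<le> n" "cut x i a d" "u \<le> i" "i < x u"
  shows "u = a"
proof -
  have b: "bij x" using assms(1) by (rule hamiltonian_tour_bij)
  have "inv x (x u) = a"
    by (rule hamiltonian_tour_arc_in[OF hamiltonian_tour_inv[OF assms(1)] assms(2) cut_inv[OF b assms(3)]])
       (use assms(4,5) b in \<open>simp_all add: bij_is_inj\<close>)
  with b show ?thesis by (simp add: bij_is_inj)
qed

text \<open>
  The largest city visited between \<open>i + 1\<close> and the return to \<open>{1..i}\<close> is a peak. As it is not \<open>n\<close>,
  it is a step-back peak, and this forces the excursion to consist of \<open>i + 2\<close> alone.
\<close>

lemma excursion_step_back: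
  assumes psb: "psb_tour n x" and i: "i + 1 < n" and c: "cut x i a d"
    and nd: "x (i + 1) \<noteq> d"
    and m: "(x ^^ m) (i + 1) \<le> i" "\<And>j. j < m \<Longrightarrow> i < (x ^^ j) (i + 1)"
    and n: "\<And>j. j < m \<Longrightarrow> (x ^^ j) (i + 1) \<noteq> n"
  shows "x (i + 1) = i + 2 \<and> x (i + 2) = d \<and> i + 2 < n"
proof -
  define p where "p j = (x ^^ j) (i + 1)" for j
  have h: "hamiltonian_tour n x" using psb by (rule psb_tour_hamiltonian)
  have b: "bij x" using h by (rule hamiltonian_tour_bij)
  have p0: "p 0 = i + 1" and pS: "x (p j) = p (Suc j)" for j
    by (simp_all add: p_def)
  have invp: "inv x (p (Suc j)) = p j" for j
    using b by (simp add: pS[symmetric] bij_is_inj)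
  have pn: "p j \<in> {1..n}" for j
    unfolding p_def using hamiltonian_tour_funpow_in[OF h, of "i + 1"] i by simp
  have lowm: "p m \<le> i" and high: "j < m \<Longrightarrow> i < p j" for j
    using m by (simp_all add: p_def)
  have m0: "0 < m" using lowm p0 by (cases m) auto
  have pm: "p m = d"
  proof -
    obtain k where k: "m = Suc k" using m0 by (cases m) auto
    then have "x (p k) = d"
      using hamiltonian_tour_arc_in[OF h _ c, of "p k"] high[of k] lowm i pS by auto
    then show ?thesis by (simp add: k pS)
  qed
  have di: "d \<le> i" using c by (simp add: cut_def)
  have m2: "2 \<le> m"
  proof (rule ccontr)
    assume "\<not> 2 \<le> m"
    with m0 have "m = Suc 0" by simp
    with pm pS[of 0] p0 nd show False by simp
  qed
  \<comment> \<open>A return to \<open>i + 1\<close> at time \<open>j\<close> would bring the walk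
    below the cut already at time \<open>m - j\<close>.\<close>
  have high': "i + 1 < p j" if "0 < j" "j < m" for j
  proof -
    have "p j \<noteq> i + 1"
    proof
      assume "p j = i + 1"
      then have "p (m - j) = (x ^^ (m - j)) (p j)" by (simp add: p_def)
      also have "\<dots> = (x ^^ (m - j + j)) (i + 1)"
        unfolding p_def by (simp add: funpow_add)
      also have "\<dots> = p m" using that by (simp add: p_def)
      finally have "p (m - j) \<le> i" using lowm by simp
      moreover have "i < p (m - j)" using that by (intro high) simp
      ultimately show False by simp
    qed
    with high[OF that(2)] show ?thesis by simp
  qed
  \<comment> \<open>Time \<open>0\<close> is left out so that the maximum has a predecessor on the
    excursion; by \<open>high'\<close> the city \<open>i + 1\<close> is not the maximum
    anyway.\<close>
  define S where "S = p ` {1..<m}"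
  have finS: "finite S" and neS: "S \<noteq> {}" using m2 by (auto simp: S_def)
  obtain j where "Max S = p j" "j \<in> {1..<m}"
    using Max_in[OF finS neS] unfolding S_def by (elim imageE)
  then have j: "0 < j" "j < m" "Max S = p j" by auto
  have le: "p k \<le> p j" if "k < m" for k
  proof (cases "k = 0")
    case True
    then show ?thesis using high'[OF j(1,2)] p0 by simp
  next
    case False
    then have "p k \<in> S" using that by (auto simp: S_def)
    then show ?thesis using finS j(3) by (metis Max_ge)
  qed
  have le': "p k \<le> p j" if "k \<le> m" for k
  proof (cases "k = m")
    case True
    then show ?thesis using lowm high[OF j(2)] by simp
  qed (use le that in simp)
  have nofix: "p (Suc k) \<noteq> p k" for k
    using hamiltonian_tour_no_fixpoint[OF h _ pn] i by (simp add: pS[symmetric])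
  obtain l where l: "j = Suc l" using j(1) by (cases j) auto
  have less1: "p (Suc j) < p j" and less2: "p l < p j"
    using le'[of "Suc j"] le'[of l] nofix[of j] nofix[of l] j l by simp_all
  have pjn: "p j < n"
    using n[OF j(2)] pn[of j] by (simp add: p_def)
  have inv: "inv x (p j) = p l" using invp l by simp
  have "peak x (p j)"
    unfolding peak_def inv pS using less1 less2 by simp
  moreover have "\<not> proper_peak x (p j)"
    using psb pn[of j] pjn i by (simp add: psb_tour_iff)
  ultimately have "step_back_peak x (p j)"
    by (simp add: proper_peak_def)
  \<comment> \<open>The first form is impossible: a city above the maximum can only follow once the
    excursion is over, so \<open>p j - 1\<close> would be \<open>d\<close>, although
    \<open>p j > i + 1\<close>. In the second form the predecessor of \<open>p l\<close> exceeds the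
    maximum, so \<open>p l\<close> is the starting city \<open>i + 1\<close> and
    \<open>p j = i + 2\<close>; nothing is left to visit before \<open>d\<close>.\<close>
  then consider "p (Suc j) = p j - 1" "p j < p (Suc (Suc j))"
    | "p j < inv x (p l)" "p l = p j - 1"
    unfolding step_back_peak_def numeral_2_eq_2 funpow.simps comp_apply id_apply inv pS by blast
  then show ?thesis
  proof cases
    case 1
    then have "\<not> Suc (Suc j) \<le> m" using le'[of "Suc (Suc j)"] by auto
    then have "Suc j = m" using j(2) by simp
    then show ?thesis using 1 pm di high'[OF j(1,2)] by simp
  next
    case 2
    have "l = 0"
    proof (rule ccontr)
      assume "l \<noteq> 0"
      then obtain k where k: "l = Suc k" by (cases l) auto
      then have "inv x (p l) = p k" using invp by simp
      then show False using 2 le[of k] k l j(2) by simp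
    qed
    then have pj: "p j = i + 2" "j = 1" using 2 p0 l high'[OF j(1,2)] by simp_all
    have "m = 2"
    proof (rule ccontr)
      assume "m \<noteq> 2"
      with m2 have "Suc 1 < m" by simp
      then have "p (Suc 1) = p 1" using le[of "Suc 1"] high'[of "Suc 1"] pj by simp
      with nofix show False by blast
    qed
    have "x (i + 1) = i + 2" using pS[of 0] p0 pj by simp
    moreover have "x (i + 2) = d"
      using pS[of 1] pj pm \<open>m = 2\<close> by (simp add: numeral_2_eq_2)
    ultimately show ?thesis using pjn pj by simp
  qed
qed

lemma least_funpow_below:
  fixes x :: "nat \<Rightarrow> nat"
  assumes "hamiltonian_tour n x" "u \<in> {1..n}" "1 \<le> i" "i \<le> n"
  obtains m where "(x ^^ m) u \<le> i" "\<And>j. j < m \<Longrightarrow> i < (x ^^ j) u"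
proof -
  obtain k where "(x ^^ k) u = 1"
    using hamiltonian_tour_reach[OF assms(1,2), of 1] assms(3,4) by auto
  then have ex: "\<exists>k. (x ^^ k) u \<le> i"
    using assms(3) by (intro exI[of _ k]) simp
  show ?thesis
    by (rule that[of "LEAST k. (x ^^ k) u \<le> i"])
       (use LeastI_ex[OF ex] not_less_Least in \<open>auto simp: not_le[symmetric]\<close>)
qed

lemma funpow_inv_cancel:
  assumes "bij x" "k \<le> l"
  shows "(x ^^ k) ((inv x ^^ l) u) = (inv x ^^ (l - k)) u"
  using assms(2)
proof (induction k)
  case (Suc k)
  then have "l - k = Suc (l - Suc k)" by simp
  then have "(inv x ^^ (l - k)) u = inv x ((inv x ^^ (l - Suc k)) u)" by simp
  with Suc assms(1) show ?case by (simp add: bij_is_surj surj_f_inv_f)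
qed simp

text \<open>Walk from \<open>i + 1\<close> forwards and backwards until \<open>{1..i}\<close> is
  reached. The city \<open>n\<close> lies on at most one of the two walks, so
  \<open>excursion_step_back\<close> applies to the tour or to its reversal.\<close>

lemma psb_tour_detached:
  assumes psb: "psb_tour n x" and i: "i + 1 < n" and c: "cut x i a d"
    and na: "x a \<noteq> i + 1" and nd: "x (i + 1) \<noteq> d"
  shows "i + 2 < n \<and> (x a = i + 2 \<and> x (i + 2) = i + 1 \<or> x (i + 1) = i + 2 \<and> x (i + 2) = d)"
proof -
  have h: "hamiltonian_tour n x" using psb by (rule psb_tour_hamiltonian)
  have b: "bij x" using h by (rule hamiltonian_tour_bij)
  have i1: "1 \<le> i" using c by (auto simp: cut_def)
  obtain m where m: "(x ^^ m) (i + 1) \<le> i" "\<And>j. j < m \<Longrightarrow> i < (x ^^ j) (i + 1)"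
    using least_funpow_below[OF h, of "i + 1" i] i i1 by auto
  obtain l where l: "(inv x ^^ l) (i + 1) \<le> i" "\<And>j. j < l \<Longrightarrow> i < (inv x ^^ j) (i + 1)"
    using least_funpow_below[OF hamiltonian_tour_inv[OF h], of "i + 1" i] i i1 by auto
  show ?thesis
  proof (cases "\<exists>j<m. (x ^^ j) (i + 1) = n")
    case False
    then show ?thesis
      using excursion_step_back[OF psb i c nd m] by blast
  next
    case True
    then obtain j where j: "j < m" "(x ^^ j) (i + 1) = n" by blast
    \<comment> \<open>Suppose both walks meet \<open>n\<close>. Going forwards from
      \<open>n\<close>, the tour reaches \<open>i + 1\<close> after \<open>k\<close> steps and falls
      below the cut after \<open>m - j\<close> steps. If the fall comes first, it lies on the
      backward walk before time \<open>l\<close>; otherwise the forward walk falls at time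
      \<open>m - j - k\<close>, which is less than \<open>m\<close> since \<open>i + 1\<close>
      differs from \<open>n\<close>.\<close>
    have no: "(inv x ^^ k) (i + 1) \<noteq> n" if "k < l" for k
    proof
      assume k: "(inv x ^^ k) (i + 1) = n"
      have "(x ^^ m) (i + 1) = (x ^^ (m - j)) ((x ^^ j) (i + 1))"
        using j(1) by (simp flip: funpow_add[THEN fun_cong, unfolded comp_apply])
      also have "\<dots> = (x ^^ (m - j)) ((inv x ^^ k) (i + 1))" by (simp only: j k)
      finally have mk: "(x ^^ m) (i + 1) = (x ^^ (m - j)) ((inv x ^^ k) (i + 1))" .
      show False
      proof (cases "m - j \<le> k")
        case True
        then have "(x ^^ m) (i + 1) = (inv x ^^ (k - (m - j))) (i + 1)"
          using mk funpow_inv_cancel[OF b] by simp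
        moreover have "i < (inv x ^^ (k - (m - j))) (i + 1)"
          using that by (intro l(2)) simp
        ultimately show False using m(1) by simp
      next
        case False
        have "(x ^^ (m - j)) ((inv x ^^ k) (i + 1))
            = (x ^^ (m - j - k)) ((x ^^ k) ((inv x ^^ k) (i + 1)))"
          using False by (simp flip: funpow_add[THEN fun_cong, unfolded comp_apply])
        also have "\<dots> = (x ^^ (m - j - k)) (i + 1)"
          using funpow_inv_cancel[OF b, of k k] by simp
        finally have e: "(x ^^ m) (i + 1) = (x ^^ (m - j - k)) (i + 1)" using mk by simp
        have "j + k \<noteq> 0"
        proof
          assume "j + k = 0"
          then have "i + 1 = n" using k by simp
          then show False using i by simp
        qed
        then have "i < (x ^^ (m - j - k)) (i + 1)"
          using False by (intro m(2)) linarith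
        then show False using e m(1) by simp
      qed
    qed
    have "inv x (i + 1) \<noteq> a"
      using na b by (metis bij_inv_eq_iff)
    from excursion_step_back[OF psb_tour_inv[OF psb] i cut_inv[OF b c] this l no]
    have "inv x (i + 1) = i + 2 \<and> inv x (i + 2) = a \<and> i + 2 < n" .
    then show ?thesis
      using b by (metis bij_inv_eq_iff)
  qed
qed

section \<open>The four ways from one cut to the next\<close>

datatype step = Ascend | Descend | Ascend_Back | Descend_Back

text \<open>
  How a tour with \<open>cut x i a d\<close> extends to its next cut: the last argument is the triple describing
  that cut.
\<close>

fun next_cut :: "(nat \<Rightarrow> nat) \<Rightarrow> nat \<Rightarrow> nat \<Rightarrow> nat \<Rightarrow> step \<Rightarrow> nat \<times> nat \<times> nat \<Rightarrow> bool" where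
  "next_cut x i a d Ascend s \<longleftrightarrow> s = (i + 1, i + 1, d) \<and> x a = i + 1"
| "next_cut x i a d Descend s \<longleftrightarrow> s = (i + 1, a, i + 1) \<and> x (i + 1) = d"
| "next_cut x i a d Ascend_Back s \<longleftrightarrow> s = (i + 2, i + 1, d) \<and> x a = i + 2 \<and> x (i + 2) = i + 1"
| "next_cut x i a d Descend_Back s \<longleftrightarrow> s = (i + 2, a, i + 1) \<and> x (i + 1) = i + 2 \<and> x (i + 2) = d"

text \<open>City \<open>i + 1\<close> follows \<open>a\<close>, precedes \<open>d\<close>, or is
  detached from both, and then \<open>psb_tour_detached\<close> supplies a step-back. Following
  \<open>a\<close> and preceding \<open>d\<close> at once would close the cycle on
  \<open>{1..i + 1}\<close> and miss \<open>n\<close>.\<close>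

lemma psb_tour_next_cut:
  assumes psb: "psb_tour n x" and i: "i + 1 < n" and c: "cut x i a d"
  obtains s j a' d' where "next_cut x i a d s (j, a', d')" "cut x j a' d'" "j < n"
proof -
  have h: "hamiltonian_tour n x" using psb by (rule psb_tour_hamiltonian)
  have b: "bij x" using h by (rule hamiltonian_tour_bij)
  have inj: "x u = x v \<longleftrightarrow> u = v" for u v using b by (simp add: bij_is_inj inj_eq)
  have xinv: "inv x (x u) = u" "x (inv x u) = u" for u
    using b by (simp_all add: bij_is_inj bij_is_surj surj_f_inv_f)
  have ine: "inv x u = v \<longleftrightarrow> x v = u" for u v
    using xinv by metis
  have in1: "d \<noteq> x d'" if "d' \<in> {1..i}" for d'
    using c that xinv(1)[of d'] by (auto simp: cut_def)
  from c have ad: "a \<in> {1..i}" "d \<in> {1..i}" "i < x a" "i < inv x d"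
    and xl: "u \<in> {1..i} \<Longrightarrow> u \<noteq> a \<Longrightarrow> x u \<le> i"
    and il: "u \<in> {1..i} \<Longrightarrow> u \<noteq> d \<Longrightarrow> inv x u \<le> i" for u
    by (auto simp: cut_def)
  have up: "i < x (i + 1)" if "x (i + 1) \<noteq> d"
    using hamiltonian_tour_arc_in[OF h _ c, of "i + 1"] that i by (cases "x (i + 1) \<le> i") auto
  have up': "i < inv x (i + 1)" if "x a \<noteq> i + 1"
  proof (rule ccontr)
    assume "\<not> i < inv x (i + 1)"
    then have "inv x (i + 1) = a"
      using hamiltonian_tour_arc_out[OF h _ c, of "inv x (i + 1)"] xinv i by simp
    with that show False using xinv(2)[of "i + 1"] by simp
  qed
  have nofix: "x (i + 1) \<noteq> i + 1"
    using hamiltonian_tour_no_fixpoint[OF h] i by simp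
  then have nofix': "inv x (i + 1) \<noteq> i + 1" using ine by metis
  show ?thesis
  proof (cases "x a = i + 1")
    case xa: True
    have nd: "x (i + 1) \<noteq> d"
    proof
      assume xd: "x (i + 1) = d"
      have "{1..n} \<subseteq> {1..i + 1}"
      proof (rule hamiltonian_tour_closed[OF h])
        fix v assume v: "v \<in> {1..i + 1}"
        then have "x v \<in> {1..n}" using i by (intro hamiltonian_tour_in[OF h]) auto
        moreover have "x v \<le> i + 1"
          using v xl[of v] xa xd ad(2) by (cases "v = a"; cases "v = i + 1") auto
        ultimately show "x v \<in> {1..i + 1}" by simp
      qed (use i in auto)
      then show False using i by auto
    qed
    have "inv x d \<noteq> i + 1" using nd ine by metis
    moreover have "i + 1 < x (i + 1)" using up[OF nd] nofix by simp
    moreover have "x u \<le> i + 1" if "u \<in> {1..i + 1} - {i + 1}" for u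
      using xl[of u] that xa by (cases "u = a") auto
    moreover have "inv x u \<le> i + 1" if "u \<in> {1..i + 1} - {d}" for u
      using il[of u] that xa ine[of "i + 1" a] ad(1) by (cases "u = i + 1") auto
    ultimately have "cut x (i + 1) (i + 1) d"
      using ad by (auto simp: cut_def)
    then show ?thesis
      using xa i by (intro that[of Ascend "i + 1" "i + 1" d]) auto
  next
    case na: False
    show ?thesis
    proof (cases "x (i + 1) = d")
      case xd: True
      have "i + 1 < inv x (i + 1)" using up'[OF na] nofix' by simp
      moreover have "x u \<le> i + 1" if "u \<in> {1..i + 1} - {a}" for u
        using xl[of u] that xd ad(2) by (cases "u = i + 1") auto
      moreover have "inv x u \<le> i + 1" if "u \<in> {1..i + 1} - {i + 1}" for u
        using il[of u] that xd ine[of d "i + 1"] by (cases "u = d") auto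
      ultimately have "cut x (i + 1) a (i + 1)"
        using ad na by (auto simp: cut_def)
      then show ?thesis
        using xd i by (intro that[of Descend "i + 1" a "i + 1"]) auto
    next
      case nd: False
      from psb_tour_detached[OF psb i c na nd]
      consider (A) "i + 2 < n" "x a = i + 2" "x (i + 2) = i + 1"
        | (D) "i + 2 < n" "x (i + 1) = i + 2" "x (i + 2) = d" by blast
      then show ?thesis
      proof cases
        case A
        have "x (i + 1) \<noteq> i + 2" using A(2) inj[of "i + 1" a] ad(1) by auto
        then have "i + 2 < x (i + 1)" using up[OF nd] nofix by simp
        moreover have "inv x d \<noteq> i + 1" "inv x d \<noteq> i + 2"
          using nd A(3) ad(2) ine by auto
        moreover have "x u \<le> i + 2" if "u \<in> {1..i + 2} - {i + 1}" for u
        proof -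
          have "u \<in> {1..i} \<or> u = i + 2" using that by auto
          then show ?thesis using xl[of u] A(2,3) by (cases "u = a") auto
        qed
        moreover have "inv x u \<le> i + 2" if "u \<in> {1..i + 2} - {d}" for u
        proof -
          have "u \<in> {1..i} \<or> u = i + 1 \<or> u = i + 2" using that by auto
          moreover have "inv x (i + 1) = i + 2" "inv x (i + 2) = a"
            using A(2,3) ine by auto
          ultimately show ?thesis using il[of u] that ad(1) by auto
        qed
        ultimately have "cut x (i + 2) (i + 1) d"
          using ad by (auto simp: cut_def)
        then show ?thesis
          using A by (intro that[of Ascend_Back "i + 2" "i + 1" d]) auto
      next
        case D
        have "inv x (i + 1) \<noteq> i + 2" using D(3) ad(2) ine by auto
        then have "i + 2 < inv x (i + 1)" using up'[OF na] nofix' by simp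
        moreover have "x a \<noteq> i + 2" using D(2) inj[of a "i + 1"] ad(1) by auto
        moreover have "x u \<le> i + 2" if "u \<in> {1..i + 2} - {a}" for u
        proof -
          have "u \<in> {1..i} \<or> u = i + 1 \<or> u = i + 2" using that by auto
          then show ?thesis using xl[of u] that D(2,3) ad(2) by auto
        qed
        moreover have "inv x u \<le> i + 2" if "u \<in> {1..i + 2} - {i + 1}" for u
        proof -
          have "u \<in> {1..i} \<or> u = i + 2" using that by auto
          moreover have "inv x (i + 2) = i + 1" "inv x d = i + 2"
            using D(2,3) ine by auto
          ultimately show ?thesis using il[of u] by (cases "u = d") auto
        qed
        ultimately have "cut x (i + 2) a (i + 1)"
          using ad na by (auto simp: cut_def)
        then show ?thesis
          using D by (intro that[of Descend_Back "i + 2" a "i + 1"]) auto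
      qed
    qed
  qed
qed

section \<open>The upper bound\<close>

lemma lookup_scaleR: "Poly_Mapping.lookup (r *\<^sub>R v) k = r *\<^sub>R Poly_Mapping.lookup v k"
proof -
  have "finite {k. r *\<^sub>R Poly_Mapping.lookup v k \<noteq> 0}"
    by (rule finite_subset[OF _ finite_lookup[of v]]) auto
  then show ?thesis
    by (simp add: scaleR_poly_mapping_def Abs_poly_mapping_inverse)
qed

text \<open>For \<open>n = 1\<close> the only tour is a loop, which is not an arc; from
  \<open>n = 2\<close> on a tour has no fixpoint, so all its pairs are arcs.\<close>

lemma lookup_char_vec_tour:
  assumes "hamiltonian_tour n x" "2 \<le> n"
  shows "Poly_Mapping.lookup (char_vec n x) (u, v) = (if u \<in> {1..n} \<and> x u = v then 1 else 0)"
  using hamiltonian_tour_in[OF assms(1), of u] hamiltonian_tour_no_fixpoint[OF assms, of u]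
  by (auto simp: lookup_char_vec arcs_def)

lemma char_vec_inject:
  assumes x: "hamiltonian_tour n x" and y: "hamiltonian_tour n y" and n: "2 \<le> n"
    and eq: "char_vec n x = char_vec n y"
  shows "x = y"
proof
  fix u
  show "x u = y u"
  proof (cases "u \<in> {1..n}")
    case True
    have "Poly_Mapping.lookup (char_vec n y) (u, x u) = 1"
      using True by (simp add: eq[symmetric] lookup_char_vec_tour[OF x n])
    then show ?thesis
      by (simp add: lookup_char_vec_tour[OF y n] split: if_splits)
  next
    case False
    then show ?thesis using hamiltonian_tour_out x y by metis
  qed
qed

text \<open>In a coordinate where two 0/1 vectors differ, a proper convex combination lies strictly
  between 0 and 1.\<close>

lemma char_vec_notin_open_segment:
  "char_vec n z \<notin> open_segment (char_vec n x) (char_vec n y)"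
proof
  assume "char_vec n z \<in> open_segment (char_vec n x) (char_vec n y)"
  then obtain r where ne: "char_vec n x \<noteq> char_vec n y" and r: "0 < r" "r < 1"
    and z: "char_vec n z = (1 - r) *\<^sub>R char_vec n x + r *\<^sub>R char_vec n y"
    by (auto simp: in_segment)
  from ne obtain k where
    k: "Poly_Mapping.lookup (char_vec n x) k \<noteq> Poly_Mapping.lookup (char_vec n y) k"
    by (meson poly_mapping_eqI)
  have "Poly_Mapping.lookup (char_vec n z) k
      = (1 - r) * Poly_Mapping.lookup (char_vec n x) k + r * Poly_Mapping.lookup (char_vec n y) k"
    by (simp add: z lookup_add lookup_scaleR)
  with k r show False
    by (cases k) (auto simp: lookup_char_vec split: if_splits)
qed

lemma line_between:
  fixes p e :: "'a::real_vector"
  assumes "b < a" "a < c" "e \<noteq> 0"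
  shows "p + a *\<^sub>R e \<in> open_segment (p + b *\<^sub>R e) (p + c *\<^sub>R e)"
proof -
  define r where "r = (a - b) / (c - b)"
  have "r * (c - b) = a - b" using assms(1,2) by (simp add: r_def)
  then have "(1 - r) * b + r * c = a" by (simp add: algebra_simps)
  moreover have "0 < r" "r < 1"
    using assms(1,2) by (simp_all add: r_def)
  ultimately have r: "0 < r" "r < 1" "(1 - r) * b + r * c = a" by simp_all
  have "(1 - r) *\<^sub>R (p + b *\<^sub>R e) + r *\<^sub>R (p + c *\<^sub>R e) = p + ((1 - r) * b + r * c) *\<^sub>R e"
    by (simp add: algebra_simps)
  with r assms show ?thesis
    by (auto simp: in_segment intro!: exI[of _ r])
qed

text \<open>Combined with \<open>char_vec_notin_open_segment\<close>, this prevents an edge from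
  containing three distinct characteristic vectors.\<close>

lemma line_betweenness:
  fixes p q :: "'a::real_vector"
  assumes "{a, b, c} \<subseteq> affine hull {p, q}" "a \<noteq> b" "b \<noteq> c" "a \<noteq> c"
  shows "a \<in> open_segment b c \<or> b \<in> open_segment a c \<or> c \<in> open_segment a b"
proof -
  obtain \<alpha> \<beta> \<gamma> where abc: "a = p + \<alpha> *\<^sub>R (q - p)" "b = p + \<beta> *\<^sub>R (q - p)" "c = p + \<gamma> *\<^sub>R (q - p)"
    using assms(1) by (auto simp: affine_hull_2_alt)
  have "q - p \<noteq> 0" using abc assms(2) by auto
  note lb = line_between[OF _ _ this, of _ _ _ p]
  consider "\<alpha> < \<beta> \<and> \<beta> < \<gamma>" | "\<alpha> < \<gamma> \<and> \<gamma> < \<beta>" | "\<beta> < \<alpha> \<and> \<alpha> < \<gamma>"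
    | "\<beta> < \<gamma> \<and> \<gamma> < \<alpha>" | "\<gamma> < \<alpha> \<and> \<alpha> < \<beta>" | "\<gamma> < \<beta> \<and> \<beta> < \<alpha>"
    using abc assms(2-4) by (metis linorder_neq_iff)
  then show ?thesis
    using lb[of \<alpha> \<beta> \<gamma>] lb[of \<alpha> \<gamma> \<beta>] lb[of \<beta> \<alpha> \<gamma>] lb[of \<beta> \<gamma> \<alpha>] lb[of \<gamma> \<alpha> \<beta>] lb[of \<gamma> \<beta> \<alpha>]
    unfolding abc[symmetric] by cases (simp_all add: open_segment_commute)
qed

lemma char_vec_in_PSB: "psb_tour n x \<Longrightarrow> char_vec n x \<in> PSB n"
  by (auto simp: PSB_def intro: hull_inc)

text \<open>
  Exchanging the parts of \<open>x\<close> and \<open>y\<close> below the cut yields two tours with the same midpoint as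
  \<open>x\<close> and \<open>y\<close>; they are new unless \<open>x\<close> and \<open>y\<close> agree below or above the cut.
\<close>

lemma adjacent_cut_agree:
  assumes n: "2 \<le> n" and x: "psb_tour n x" and y: "psb_tour n y" and i: "i < n"
    and cut: "cut x i a d" "cut y i a d"
    and adj: "adjacent (PSB n) (char_vec n x) (char_vec n y)"
  shows "(\<forall>u \<in> {1..i} - {a}. x u = y u) \<or> (\<forall>u \<in> - ({1..i} - {a}). x u = y u)"
proof (rule ccontr)
  assume contra: "\<not> ?thesis"
  let ?v = "char_vec n"
  define z w where "z = splice i a x y" and "w = splice i a y x"
  have zpsb: "psb_tour n z" and wpsb: "psb_tour n w"
    unfolding z_def w_def using psb_tour_splice x y i cut by blast+
  note h = psb_tour_hamiltonian[OF x] psb_tour_hamiltonian[OF y] psb_tour_hamiltonian[OF zpsb]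
  \<comment> \<open>The negated goal gives a difference between \<open>x\<close> and
    \<open>y\<close> on either side of the cut, and each side separates the splice from one of
    them.\<close>
  have "z \<noteq> x" "z \<noteq> y"
    using contra unfolding z_def splice_def fun_eq_iff by (metis ComplD)+
  then have vz: "?v z \<noteq> ?v x" "?v z \<noteq> ?v y"
    using char_vec_inject[OF _ _ n] h by metis+
  have sum: "?v x + ?v y = ?v z + ?v w"
    by (rule poly_mapping_eqI)
       (auto simp: lookup_add lookup_char_vec z_def w_def splice_def)
  obtain F where F: "F face_of PSB n" "has_aff_dim F 1" "?v x \<in> F" "?v y \<in> F"
    and xy: "?v x \<noteq> ?v y"
    using adj by (auto simp: adjacent_def is_edge_of_def)
  let ?m = "(1 / 2) *\<^sub>R ?v x + (1 / 2) *\<^sub>R ?v y"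
  have mF: "?m \<in> F"
    using F(1,3,4) unfolding face_of_def by (intro convexD) auto
  have m: "?m = (1 / 2) *\<^sub>R ?v z + (1 / 2) *\<^sub>R ?v w"
    using sum by (metis scaleR_add_right)
  \<comment> \<open>Equal vectors would coincide with the midpoint of the two 0/1 vectors of
    \<open>x\<close> and \<open>y\<close>.\<close>
  have "?v z \<noteq> ?v w"
  proof
    assume "?v z = ?v w"
    then have "?v z = ?m" unfolding m by (simp flip: scaleR_add_left)
    then have "?v z \<in> open_segment (?v x) (?v y)"
      using xy by (auto simp: in_segment intro!: exI[of _ "1 / 2"])
    with char_vec_notin_open_segment show False by blast
  qed
  then have "?m \<in> open_segment (?v z) (?v w)"
    unfolding m by (auto simp: in_segment intro!: exI[of _ "1 / 2"])
  \<comment> \<open>A face containing an inner point of a segment of the polytope contains its ends,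
    so the edge \<open>F\<close> acquires a third characteristic vector.\<close>
  then have zF: "?v z \<in> F"
    using F(1) mF char_vec_in_PSB zpsb wpsb unfolding face_of_def by blast
  obtain B where B: "affine hull B = affine hull F" "card B = 2"
    using F(2) by (auto simp: has_aff_dim_def)
  then obtain p q where "B = {p, q}" by (auto simp: card_2_iff)
  with B F zF have "{?v x, ?v y, ?v z} \<subseteq> affine hull {p, q}"
    using hull_subset[of F affine] by auto
  from line_betweenness[OF this] xy vz show False
    using char_vec_notin_open_segment by metis
qed

text \<open>Makes the choice uniform over \<open>S\<close>. If \<open>x\<close>, \<open>y\<close>
  differ at \<open>u\<close> in \<open>A\<close>, they agree outside \<open>A\<close>. If another
  pair differs at \<open>v\<close> outside \<open>A\<close>, one of its members \<open>t\<close>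
  differs from both \<open>x\<close> and \<open>y\<close> at \<open>v\<close>, hence agrees with
  both at \<open>u\<close>, which is absurd.\<close>

lemma agreement_dichotomy:
  assumes "\<And>x y. x \<in> S \<Longrightarrow> y \<in> S \<Longrightarrow> (\<forall>u \<in> A. x u = y u) \<or> (\<forall>u \<in> - A. x u = y u)"
  shows "(\<forall>x \<in> S. \<forall>y \<in> S. \<forall>u \<in> A. x u = y u) \<or> (\<forall>x \<in> S. \<forall>y \<in> S. \<forall>u \<in> - A. x u = y u)"
proof (rule ccontr)
  assume "\<not> ?thesis"
  then obtain x y u z w v where xy: "x \<in> S" "y \<in> S" "u \<in> A" "x u \<noteq> y u"
    and zw: "z \<in> S" "w \<in> S" "v \<in> - A" "z v \<noteq> w v" by blast
  have xyv: "x v = y v" using assms[OF xy(1,2)] xy(3,4) zw(3) by blast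
  obtain t where t: "t \<in> S" "t v \<noteq> x v" using zw by metis
  have "t u = x u" using assms[OF t(1) xy(1)] t(2) zw(3) xy(3) by blast
  moreover have "t u = y u" using assms[OF t(1) xy(2)] t(2) xyv zw(3) xy(3) by metis
  ultimately show False using xy(4) by simp
qed

text \<open>A code is a state and the step taken from it. One end is always close to
  \<open>i\<close>, which saves a factor \<open>n\<close>; the value \<open>i - 1\<close> arises
  after a step-back, where \<open>i\<close> is visited just before or after the new end
  \<open>i - 1\<close>.\<close>

definition cut_codes :: "nat \<Rightarrow> (nat \<times> nat \<times> nat \<times> step) set" where
  "cut_codes n = {(i, a, d, s). i \<in> {1..n} \<and> a \<in> {1..n} \<and> d \<in> {1..n} \<and>
     (a \<in> {i - 1, i} \<or> d \<in> {i - 1, i})}"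

lemma UNIV_step: "UNIV = {Ascend, Descend, Ascend_Back, Descend_Back}"
proof -
  have "s \<in> {Ascend, Descend, Ascend_Back, Descend_Back}" for s
    by (cases s) auto
  then show ?thesis by blast
qed

lemma card_cut_codes: "finite (cut_codes n) \<and> card (cut_codes n) \<le> 16 * n ^ 2"
proof -
  \<comment> \<open>Data: \<open>i\<close>, the far end \<open>e\<close>, a bit telling which end is
    close to \<open>i\<close>, a bit choosing between \<open>i\<close> and \<open>i - 1\<close>, and
    one of four steps, hence \<open>n * n * 2 * 2 * 4\<close> possibilities.\<close>
  let ?D = "{1..n} \<times> {1..n} \<times> (UNIV :: bool set) \<times> (UNIV :: bool set) \<times> (UNIV :: step set)"
  let ?f = "\<lambda>(i, e, b, c, s). if b then (i, if c then i else i - 1, e, s)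
              else (i, e, if c then i else i - 1, s)"
  have "cut_codes n \<subseteq> ?f ` ?D"
  proof
    fix t assume "t \<in> cut_codes n"
    then obtain i a d s where t: "t = (i, a, d, s)" "i \<in> {1..n}" "a \<in> {1..n}" "d \<in> {1..n}"
      "a \<in> {i - 1, i} \<or> d \<in> {i - 1, i}" by (auto simp: cut_codes_def)
    show "t \<in> ?f ` ?D"
    proof (cases "a \<in> {i - 1, i}")
      case True
      then have e: "t = ?f (i, d, True, a = i, s)" using t(1) by auto
      show ?thesis unfolding e by (rule imageI) (use t in simp)
    next
      case False
      then have e: "t = ?f (i, a, False, d = i, s)" using t(1,5) by auto
      show ?thesis unfolding e by (rule imageI) (use t in simp)
    qed
  qed
  moreover have fin: "finite ?D" by (simp add: UNIV_step)
  moreover have "card ?D = 16 * n ^ 2"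
    by (simp add: card_cartesian_product UNIV_step card_UNIV_bool power2_eq_square)
  ultimately have "finite (?f ` ?D)" "card (?f ` ?D) \<le> 16 * n ^ 2" "cut_codes n \<subseteq> ?f ` ?D"
    using card_image_le[OF fin, of ?f] by simp_all
  then show ?thesis by (meson card_mono finite_subset order_trans)
qed

section \<open>Codes of the tours in a clique\<close>

definition agree_below :: "(nat \<Rightarrow> nat) set \<Rightarrow> nat \<Rightarrow> nat \<Rightarrow> nat \<Rightarrow> bool" where
  "agree_below T i a d \<longleftrightarrow>
     (\<forall>x \<in> {x \<in> T. cut x i a d}. \<forall>y \<in> {x \<in> T. cut x i a d}. \<forall>u \<in> {1..i} - {a}. x u = y u)"

definition agree_above :: "(nat \<Rightarrow> nat) set \<Rightarrow> nat \<Rightarrow> nat \<Rightarrow> nat \<Rightarrow> bool" where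
  "agree_above T i a d \<longleftrightarrow>
     (\<forall>x \<in> {x \<in> T. cut x i a d}. \<forall>y \<in> {x \<in> T. cut x i a d}. \<forall>u \<in> - ({1..i} - {a}). x u = y u)"

text \<open>The code marks a place along \<open>x\<close> where agreement below turns into agreement
  above. The second state is not recorded, since the first one and the step determine it.\<close>

definition has_cut_code ::
    "(nat \<Rightarrow> nat) set \<Rightarrow> (nat \<Rightarrow> nat) \<Rightarrow> nat \<times> nat \<times> nat \<times> step \<Rightarrow> bool" where
  "has_cut_code T x = (\<lambda>(i, a, d, s). cut x i a d \<and> agree_below T i a d \<and>
     (\<exists>j a' d'. next_cut x i a d s (j, a', d') \<and> cut x j a' d' \<and> agree_above T j a' d'))"

text \<open>Agreement below the first state and above the second leaves open at most the successors
  of \<open>a\<close>, \<open>i + 1\<close> and \<open>i + 2\<close>, and where these are open the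
  step prescribes them.\<close>

lemma has_cut_code_unique:
  assumes "x \<in> T" "y \<in> T" "has_cut_code T x c" "has_cut_code T y c"
  shows "x = y"
proof
  fix u
  obtain i a d s where c: "c = (i, a, d, s)" by (cases c) auto
  obtain j a' d' where x: "cut x i a d" "agree_below T i a d" "next_cut x i a d s (j, a', d')"
      "cut x j a' d'" "agree_above T j a' d'"
    using assms(3) by (auto simp: c has_cut_code_def)
  obtain j2 a2 d2 where y: "cut y i a d" "next_cut y i a d s (j2, a2, d2)" "cut y j2 a2 d2"
    using assms(4) by (auto simp: c has_cut_code_def)
  have "(j2, a2, d2) = (j, a', d')" using x(3) y(2) by (cases s) auto
  then have y': "next_cut y i a d s (j, a', d')" "cut y j a' d'" using y by auto
  have below: "x u = y u" if "u \<in> {1..i} - {a}"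
    using x(1,2) y(1) assms(1,2) that unfolding agree_below_def by blast
  have above: "x u = y u" if "u \<in> - ({1..j} - {a'})"
    using x(4,5) y'(2) assms(1,2) that unfolding agree_above_def by blast
  consider "u \<in> {1..i} - {a}" | "u \<in> - ({1..j} - {a'})"
    | "u \<notin> {1..i} - {a}" "u \<in> {1..j} - {a'}" by blast
  then show "x u = y u"
  proof cases
    case 3
    then have "u = a \<or> u = i + 1 \<or> u = i + 2" using x(3) by (cases s) auto
    with 3 x(3) y'(1) show ?thesis by (cases s) auto
  qed (use below above in auto)
qed

lemma cut_first:
  assumes "hamiltonian_tour n x" "2 \<le> n"
  shows "cut x 1 1 1"
proof -
  have "1 < y 1" if "hamiltonian_tour n y" for y
    using hamiltonian_tour_in[OF that, of 1] hamiltonian_tour_no_fixpoint[OF that, of 1] assms(2)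
    by auto
  from this[OF assms(1)] this[OF hamiltonian_tour_inv[OF assms(1)]] show ?thesis
    by (auto simp: cut_def)
qed

text \<open>Once only \<open>n\<close> is left outside, the cut forces the arcs from
  \<open>a\<close> to \<open>n\<close> and from \<open>n\<close> to \<open>d\<close>.\<close>

lemma agree_above_last:
  assumes T: "\<And>x. x \<in> T \<Longrightarrow> hamiltonian_tour n x" and n: "2 \<le> n" and j: "j + 1 = n"
  shows "agree_above T j a d"
proof -
  have det: "x u = (if u = a then n else if u = n then d else u)"
    if x: "x \<in> T" "cut x j a d" and u: "u \<in> - ({1..j} - {a})" for x u
  proof -
    note h = T[OF x(1)]
    have a: "a \<in> {1..j}" "j < x a" using x(2) by (auto simp: cut_def)
    then have "x a = n" using hamiltonian_tour_in[OF h, of a] j by auto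
    moreover have "x n = d"
    proof (rule hamiltonian_tour_arc_in[OF h _ x(2)])
      show "x n \<le> j"
        using hamiltonian_tour_in[OF h, of n] hamiltonian_tour_no_fixpoint[OF h n, of n] n j by auto
    qed (use j in auto)
    moreover have "x u = u" if "u \<noteq> a" "u \<noteq> n"
      using that u j by (intro hamiltonian_tour_out[OF h]) auto
    ultimately show ?thesis by auto
  qed
  show ?thesis
    unfolding agree_above_def
  proof (intro ballI)
    fix x y u
    assume "x \<in> {x \<in> T. cut x j a d}" "y \<in> {x \<in> T. cut x j a d}" and u: "u \<in> - ({1..j} - {a})"
    then show "x u = y u" using det[of x u] det[of y u] by simp
  qed
qed

text \<open>The code is taken at the last state of \<open>x\<close>, among those with
  \<open>i + 1 < n\<close>, that has agreement below. Its next state then agrees above, by the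
  dichotomy or because it is the final one.\<close>

lemma exists_cut_code:
  assumes n: "3 \<le> n" and x: "x \<in> T" and T: "\<And>x. x \<in> T \<Longrightarrow> psb_tour n x"
    and adj: "\<And>x y. x \<in> T \<Longrightarrow> y \<in> T \<Longrightarrow> x \<noteq> y \<Longrightarrow> adjacent (PSB n) (char_vec n x) (char_vec n y)"
  shows "\<exists>c \<in> cut_codes n. has_cut_code T x c"
proof -
  note h = psb_tour_hamiltonian[OF T]
  have dich: "agree_below T i a d \<or> agree_above T i a d" if "i < n" for i a d
    unfolding agree_below_def agree_above_def
  proof (rule agreement_dichotomy)
    fix x y assume "x \<in> {x \<in> T. cut x i a d}" "y \<in> {x \<in> T. cut x i a d}"
    then have xy: "x \<in> T" "y \<in> T" "cut x i a d" "cut y i a d" by auto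
    show "(\<forall>u \<in> {1..i} - {a}. x u = y u) \<or> (\<forall>u \<in> - ({1..i} - {a}). x u = y u)"
    proof (cases "x = y")
      case False
      with xy n that show ?thesis by (intro adjacent_cut_agree[OF _ T T _ _ _ adj]) auto
    qed simp
  qed
  define G where "G i a d \<longleftrightarrow> cut x i a d \<and> agree_below T i a d \<and> (a \<in> {i - 1, i} \<or> d \<in> {i - 1, i})"
    for i a d
  define I where "I = {i. i + 1 < n \<and> (\<exists>a d. G i a d)}"
  have "finite I" by (rule finite_subset[of _ "{..<n}"]) (auto simp: I_def)
  \<comment> \<open>Vacuous, as \<open>{1..1} - {1}\<close> is empty; this starts the search for the
    last such state.\<close>
  have "agree_below T 1 1 1" by (auto simp: agree_below_def)
  then have "G 1 1 1" using cut_first[OF h[OF x]] n by (auto simp: G_def)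
  then have "1 \<in> I" using n by (auto simp: I_def)
  with \<open>finite I\<close> have "Max I \<in> I" by (intro Max_in) auto
  then obtain i a d where i: "i = Max I" "i + 1 < n" "G i a d" by (auto simp: I_def)
  then have ci: "cut x i a d" "agree_below T i a d" by (auto simp: G_def)
  obtain s j a' d' where s: "next_cut x i a d s (j, a', d')" "cut x j a' d'" "j < n"
    using psb_tour_next_cut[OF T[OF x] i(2) ci(1)] .
  have near: "i < j" "a' \<in> {j - 1, j} \<or> d' \<in> {j - 1, j}"
    using s(1) by (cases s; auto)+
  have "agree_above T j a' d'"
  proof (cases "j + 1 = n")
    case True
    then show ?thesis using agree_above_last[OF h] n by simp
  next
    case False
    have "\<not> agree_below T j a' d'"
    proof
      assume "agree_below T j a' d'"
      with s near have "G j a' d'" by (simp add: G_def)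
      with s(3) False have "j \<in> I" by (auto simp: I_def)
      with \<open>finite I\<close> have "j \<le> i" unfolding i(1) by simp
      with near show False by simp
    qed
    with dich s(3) show ?thesis by blast
  qed
  with s ci have "has_cut_code T x (i, a, d, s)"
    unfolding has_cut_code_def by blast
  moreover have "(i, a, d, s) \<in> cut_codes n"
    using i ci(1) by (auto simp: cut_codes_def G_def cut_def)
  ultimately show ?thesis by blast
qed

lemma clique_number_PSB_le:
  assumes n: "3 \<le> n"
  shows "clique_number (PSB n) \<le> 16 * n ^ 2"
proof -
  have "card C \<le> 16 * n ^ 2" if C: "C \<subseteq> vertices (PSB n)" "pairwise (adjacent (PSB n)) C" for C
  proof -
    define T where "T = {x. psb_tour n x \<and> char_vec n x \<in> C}"
    have "C \<subseteq> char_vec n ` T"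
    proof
      fix v assume v: "v \<in> C"
      then have "v extreme_point_of convex hull (char_vec n ` {x. psb_tour n x})"
        using C(1) by (auto simp: vertices_def PSB_def)
      from extreme_point_of_convex_hull[OF this] v show "v \<in> char_vec n ` T"
        by (auto simp: T_def)
    qed
    have "\<exists>c \<in> cut_codes n. has_cut_code T x c" if "x \<in> T" for x
    proof (rule exists_cut_code[OF n that])
      fix x y assume xy: "x \<in> T" "y \<in> T" "x \<noteq> y"
      then have "char_vec n x \<noteq> char_vec n y"
        using char_vec_inject[of n x y] psb_tour_hamiltonian n by (auto simp: T_def)
      with xy C(2) show "adjacent (PSB n) (char_vec n x) (char_vec n y)"
        by (auto simp: T_def pairwise_def)
    qed (simp add: T_def)
    then obtain f where f: "\<And>x. x \<in> T \<Longrightarrow> f x \<in> cut_codes n \<and> has_cut_code T x (f x)"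
      by metis
    have "inj_on f T"
      by (rule inj_onI) (metis f has_cut_code_unique)
    moreover have "f ` T \<subseteq> cut_codes n" using f by auto
    ultimately have T: "finite T" "card T \<le> card (cut_codes n)"
      using card_cut_codes[of n] by (meson finite_subset finite_imageD card_inj_on_le)+
    have "card C \<le> card (char_vec n ` T)"
      using T(1) \<open>C \<subseteq> char_vec n ` T\<close> by (intro card_mono) auto
    also have "\<dots> \<le> card T" using T(1) by (rule card_image_le)
    finally show ?thesis using T(2) card_cut_codes[of n] by simp
  qed
  moreover have "finite {C. C \<subseteq> vertices (PSB n) \<and> pairwise (adjacent (PSB n)) C}"
    using finite_vertices_PSB[of n] by simp
  moreover have "{} \<in> {C. C \<subseteq> vertices (PSB n) \<and> pairwise (adjacent (PSB n)) C}" by simp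
  ultimately show ?thesis
    unfolding clique_number_def by (subst Max_le_iff) blast+
qed

section \<open>The lower bound\<close>

lemma lookup_PSB_nonneg:
  assumes "v \<in> PSB n"
  shows "0 \<le> Poly_Mapping.lookup v e"
proof -
  have "convex {v. 0 \<le> (Poly_Mapping.lookup v e :: real)}"
    by (rule convexI) (simp add: lookup_add lookup_scaleR)
  moreover have "char_vec n ` {x. psb_tour n x} \<subseteq> {v. 0 \<le> Poly_Mapping.lookup v e}"
    by (cases e) (auto simp: lookup_char_vec)
  ultimately have "PSB n \<subseteq> {v. 0 \<le> Poly_Mapping.lookup v e}"
    unfolding PSB_def by (intro hull_minimal)
  with assms show ?thesis by blast
qed

text \<open>All coordinates are nonnegative on the polytope, so forcing those outside
  \<open>E\<close> to vanish cuts out a face, and this face is spanned by the tours using only arcs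
  of \<open>E\<close>.\<close>

lemma face_of_PSB_arcs:
  assumes n: "2 \<le> n"
  shows "convex hull (char_vec n ` {x. psb_tour n x \<and> (\<forall>u \<in> {1..n}. (u, x u) \<in> E)}) face_of PSB n"
    (is "?F face_of _")
  unfolding face_of_def
proof (intro conjI ballI impI)
  show "?F \<subseteq> PSB n" unfolding PSB_def by (intro hull_mono) auto
  show "convex ?F" by (rule convex_convex_hull)
  let ?S = "char_vec n ` {x. psb_tour n x}"
  let ?S' = "char_vec n ` {x. psb_tour n x \<and> (\<forall>u \<in> {1..n}. (u, x u) \<in> E)}"
  have finS: "finite ?S"
  proof -
    have "finite {\<tau>. psb_tour n \<tau>}"
      by (rule finite_subset[OF _ finite_permutations[of "{1..n}"]])
         (auto simp: psb_tour_def hamiltonian_tour_def)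
    then show ?thesis by simp
  qed
  have sub: "?S' \<subseteq> ?S" by auto
  have F0: "Poly_Mapping.lookup v e = 0" if v: "v \<in> ?F" and e: "e \<notin> E" for v e
  proof -
    have "convex {v. Poly_Mapping.lookup v e = (0 :: real)}"
      by (rule convexI) (simp add: lookup_add lookup_scaleR)
    moreover have "?S' \<subseteq> {v. Poly_Mapping.lookup v e = 0}"
      using e by (cases e) (auto simp: lookup_char_vec arcs_def)
    ultimately have "?F \<subseteq> {v. Poly_Mapping.lookup v e = 0}" by (intro hull_minimal)
    with v show ?thesis by blast
  qed
  have inF: "a \<in> ?F" if a: "a \<in> PSB n" and a0: "\<And>e. e \<notin> E \<Longrightarrow> Poly_Mapping.lookup a e = 0" for a
  proof -
    obtain c where c: "\<forall>v\<in>?S. 0 \<le> c v" "sum c ?S = 1" "(\<Sum>v\<in>?S. c v *\<^sub>R v) = a"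
      using a unfolding PSB_def convex_hull_finite[OF finS] by blast
    \<comment> \<open>A tour with an arc outside \<open>E\<close> contributes its weight to that
      coordinate; as no other term is negative and the sum is zero, the weight is zero.\<close>
    have c0: "c v = 0" if v: "v \<in> ?S - ?S'" for v
    proof -
      obtain x where x: "v = char_vec n x" "psb_tour n x" using v by auto
      have "\<not> (\<forall>u \<in> {1..n}. (u, x u) \<in> E)" using v x by blast
      then obtain u where u: "u \<in> {1..n}" "(u, x u) \<notin> E" by blast
      have "(\<Sum>v\<in>?S. c v * Poly_Mapping.lookup v (u, x u)) = Poly_Mapping.lookup a (u, x u)"
        by (simp flip: c(3) add: lookup_sum lookup_scaleR)
      then have "(\<Sum>v\<in>?S. c v * Poly_Mapping.lookup v (u, x u)) = 0" using a0 u(2) by simp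
      moreover have "0 \<le> c w * Poly_Mapping.lookup w (u, x u)" if "w \<in> ?S" for w
        using that c(1) by (intro mult_nonneg_nonneg) (auto simp: lookup_char_vec)
      moreover have "v \<in> ?S" using v by blast
      ultimately have "c v * Poly_Mapping.lookup v (u, x u) = 0"
        using sum_nonneg_0[OF finS, of "\<lambda>v. c v * Poly_Mapping.lookup v (u, x u)" v] by metis
      moreover have "Poly_Mapping.lookup v (u, x u) = 1"
        using u(1) by (simp add: x(1) lookup_char_vec_tour[OF psb_tour_hamiltonian[OF x(2)] n])
      ultimately show ?thesis by simp
    qed
    have "sum c ?S' = 1" "(\<Sum>v\<in>?S'. c v *\<^sub>R v) = a"
      using c0 sum.mono_neutral_left[OF finS sub, of c]
        sum.mono_neutral_left[OF finS sub, of "\<lambda>v. c v *\<^sub>R v"] c(2,3) by simp_all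
    then show ?thesis
      using c(1) sub finite_subset[OF sub finS] by (subst convex_hull_finite) blast+
  qed
  fix a b p
  assume ab: "a \<in> PSB n" "b \<in> PSB n" and p: "p \<in> ?F" "p \<in> open_segment a b"
  obtain r where r: "0 < r" "r < 1" "p = (1 - r) *\<^sub>R a + r *\<^sub>R b"
    using p(2) by (auto simp: in_segment)
  have "Poly_Mapping.lookup a e = 0 \<and> Poly_Mapping.lookup b e = 0" if "e \<notin> E" for e
  proof -
    have "0 \<le> Poly_Mapping.lookup a e" "0 \<le> Poly_Mapping.lookup b e"
      using ab lookup_PSB_nonneg by blast+
    moreover have "(1 - r) * Poly_Mapping.lookup a e + r * Poly_Mapping.lookup b e = 0"
      using F0[OF p(1) that] r(3) by (simp add: lookup_add lookup_scaleR)
    ultimately show ?thesis using r(1,2)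
      by (auto simp: add_nonneg_eq_0_iff)
  qed
  then show "a \<in> ?F" "b \<in> ?F" using inF ab by blast+
qed

lemma hamiltonian_tour_eqI:
  assumes "hamiltonian_tour n x" "hamiltonian_tour n y" "\<And>u. u \<in> {1..n} \<Longrightarrow> x u = y u"
  shows "x = y"
  using assms hamiltonian_tour_out by (metis ext)

text \<open>The face given by the arcs of \<open>x\<close> alone is a single point.\<close>

lemma char_vec_vertex:
  assumes n: "2 \<le> n" and x: "psb_tour n x"
  shows "char_vec n x \<in> vertices (PSB n)"
proof -
  let ?E = "{(u, v). x u = v}"
  have "{z. psb_tour n z \<and> (\<forall>u \<in> {1..n}. (u, z u) \<in> ?E)} = {x}"
    using x by (auto intro!: hamiltonian_tour_eqI[of n] psb_tour_hamiltonian)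
  with face_of_PSB_arcs[OF n, of ?E] show ?thesis
    by (simp add: vertices_def face_of_singleton)
qed

text \<open>The face given by the union of the arcs of \<open>x\<close> and \<open>y\<close>
  contains no third tour, so it is the segment between the two vectors.\<close>

lemma adjacentI_arcs:
  assumes n: "2 \<le> n" and x: "psb_tour n x" and y: "psb_tour n y" and ne: "x \<noteq> y"
    and only: "\<And>z. psb_tour n z \<Longrightarrow> (\<And>u. z u = x u \<or> z u = y u) \<Longrightarrow> z = x \<or> z = y"
  shows "adjacent (PSB n) (char_vec n x) (char_vec n y)"
proof -
  let ?E = "{(u, v). x u = v \<or> y u = v}"
  have "{z. psb_tour n z \<and> (\<forall>u \<in> {1..n}. (u, z u) \<in> ?E)} = {x, y}"
  proof (intro subset_antisym subsetI)
    fix z assume "z \<in> {z. psb_tour n z \<and> (\<forall>u \<in> {1..n}. (u, z u) \<in> ?E)}"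
    then have z: "psb_tour n z" "\<forall>u \<in> {1..n}. z u = x u \<or> z u = y u" by auto
    have "z u = x u \<or> z u = y u" for u
      using z(2) hamiltonian_tour_out[OF psb_tour_hamiltonian[OF z(1)], of u]
        hamiltonian_tour_out[OF psb_tour_hamiltonian[OF x], of u] by (cases "u \<in> {1..n}") auto
    with only z(1) show "z \<in> {x, y}" by blast
  qed (use x y in auto)
  with face_of_PSB_arcs[OF n, of ?E]
  have F: "convex hull {char_vec n x, char_vec n y} face_of PSB n" (is "?F face_of _")
    by simp
  have "char_vec n x \<noteq> char_vec n y"
    using char_vec_inject[OF _ _ n] x y ne psb_tour_hamiltonian by blast
  moreover from this have "has_aff_dim ?F 1"
    unfolding has_aff_dim_def by (intro exI[of _ "{char_vec n x, char_vec n y}"]) auto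
  ultimately show ?thesis
    unfolding adjacent_def is_edge_of_def using F char_vec_vertex[OF n] x y
    by (meson hull_inc insertI1 insertI2)
qed

text \<open>The tour ascends \<open>1, s, t, n\<close> and visits all other cities on the way down.\<close>

definition three_leg_tour :: "nat \<Rightarrow> nat \<Rightarrow> nat \<Rightarrow> nat \<Rightarrow> nat" where
  "three_leg_tour n s t u =
     (if u = 1 then s else if u = s then t else if u = t then n
      else if u = s + 1 then s - 1 else if u = t + 1 then t - 1
      else if u \<in> {1..n} then u - 1 else u)"

definition three_leg_pred :: "nat \<Rightarrow> nat \<Rightarrow> nat \<Rightarrow> nat \<Rightarrow> nat" where
  "three_leg_pred n s t u =
     (if u = s then 1 else if u = t then s else if u = n then t
      else if u = s - 1 then s + 1 else if u = t - 1 then t + 1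
      else if u \<in> {1..n} then u + 1 else u)"

section \<open>Inverse, cycle structure and peaks of the three-leg tours\<close>

lemma three_leg_tour_values:
  assumes "2 \<le> s" "s + 2 \<le> t" "t < n"
  shows "three_leg_tour n s t 1 = s" "three_leg_tour n s t s = t" "three_leg_tour n s t t = n"
    "three_leg_tour n s t (s + 1) = s - 1" "three_leg_tour n s t (t + 1) = t - 1"
    "u \<notin> {1, s, t, s + 1, t + 1} \<Longrightarrow> u \<in> {1..n} \<Longrightarrow> three_leg_tour n s t u = u - 1"
    "u \<notin> {1..n} \<Longrightarrow> three_leg_tour n s t u = u"
  using assms unfolding three_leg_tour_def by auto

lemma three_leg_pred_values:
  assumes "2 \<le> s" "s + 2 \<le> t" "t < n"
  shows "three_leg_pred n s t s = 1" "three_leg_pred n s t t = s" "three_leg_pred n s t n = t"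
    "three_leg_pred n s t (s - 1) = s + 1" "three_leg_pred n s t (t - 1) = t + 1"
    "u \<notin> {s, t, n, s - 1, t - 1} \<Longrightarrow> u \<in> {1..n} \<Longrightarrow> three_leg_pred n s t u = u + 1"
    "u \<notin> {1..n} \<Longrightarrow> three_leg_pred n s t u = u"
  using assms unfolding three_leg_pred_def by auto

lemma three_leg_pred_tour:
  assumes st: "2 \<le> s" "s + 2 \<le> t" "t < n"
  shows "three_leg_pred n s t (three_leg_tour n s t u) = u"
    and "three_leg_tour n s t (three_leg_pred n s t u) = u"
proof -
  note x = three_leg_tour_values[OF st] and y = three_leg_pred_values[OF st]
  show "three_leg_pred n s t (three_leg_tour n s t u) = u"
  proof (cases "u \<in> {1, s, t, s + 1, t + 1} \<or> u \<notin> {1..n}")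
    case True
    then show ?thesis using x(1-5,7) y(1-5,7) by (elim disjE insertE; simp)
  next
    case False
    then have "three_leg_tour n s t u = u - 1" using x(6) by blast
    moreover have "three_leg_pred n s t (u - 1) = u - 1 + 1"
    proof (rule y(6))
      show "u - 1 \<notin> {s, t, n, s - 1, t - 1}" "u - 1 \<in> {1..n}" using False st by auto
    qed
    ultimately show ?thesis using False by simp
  qed
  show "three_leg_tour n s t (three_leg_pred n s t u) = u"
  proof (cases "u \<in> {s, t, n, s - 1, t - 1} \<or> u \<notin> {1..n}")
    case True
    then show ?thesis using x(1-5,7) y(1-5,7) by (elim disjE insertE; simp)
  next
    case False
    then have "three_leg_pred n s t u = u + 1" using y(6) by blast
    moreover have "three_leg_tour n s t (u + 1) = u + 1 - 1"
    proof (rule x(6))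
      show "u + 1 \<notin> {1, s, t, s + 1, t + 1}" using False st by simp linarith
      show "u + 1 \<in> {1..n}" using False st by simp
    qed
    ultimately show ?thesis by simp
  qed
qed

lemma three_leg_bij:
  assumes "2 \<le> s" "s + 2 \<le> t" "t < n"
  shows "bij (three_leg_tour n s t)"
  by (rule o_bij[of "three_leg_pred n s t"])
     (auto simp: fun_eq_iff three_leg_pred_tour[OF assms])

lemma inv_three_leg_tour:
  assumes "2 \<le> s" "s + 2 \<le> t" "t < n"
  shows "inv (three_leg_tour n s t) = three_leg_pred n s t"
  by (rule inv_unique_comp) (auto simp: fun_eq_iff three_leg_pred_tour[OF assms])

lemma hamiltonian_three_leg_tour:
  assumes st: "2 \<le> s" "s + 2 \<le> t" "t < n"
  shows "hamiltonian_tour n (three_leg_tour n s t)"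
proof (rule hamiltonian_tourI)
  let ?x = "three_leg_tour n s t"
  show "?x permutes {1..n}"
  proof (rule bij_imp_permutes)
    show "?x u = u" if "u \<notin> {1..n}" for u
      using that st unfolding three_leg_tour_def by auto
    have "?x ` {1..n} \<subseteq> {1..n}"
      using st unfolding three_leg_tour_def by auto
    moreover have "inj_on ?x {1..n}"
      using three_leg_bij[OF st] by (meson bij_is_inj inj_on_subset subset_UNIV)
    ultimately show "bij_betw ?x {1..n} {1..n}"
      by (simp add: bij_betw_def endo_inj_surj)
  qed
  show "n \<in> {1..n}" using st by simp
  define R where "R = {u. \<exists>k. (?x ^^ k) n = u}"
  have R0: "n \<in> R" unfolding R_def by (auto intro: exI[of _ 0])
  have RS: "?x u \<in> R" if "u \<in> R" for u
    using that unfolding R_def by (auto intro: exI[of _ "Suc k" for k])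
  \<comment> \<open>Descent from \<open>n\<close>: the predecessor of such a \<open>u\<close> is
    larger and again differs from \<open>s\<close> and \<open>t\<close>, because
    \<open>s + 2 \<le> t\<close>. The descent ends at \<open>1\<close>, from where the tour jumps to
    \<open>s\<close> and then to \<open>t\<close>.\<close>
  have down: "u \<in> R" if "1 \<le> u" "u \<le> n" "u \<noteq> s" "u \<noteq> t" for u
    using that
  proof (induction "n - u" arbitrary: u rule: less_induct)
    case less
    let ?w = "three_leg_pred n s t u"
    show ?case
    proof (cases "u = n")
      case False
      then have w: "u < ?w" "?w \<le> n" "?w \<noteq> s" "?w \<noteq> t"
        using less.prems st unfolding three_leg_pred_def by (auto split: if_splits)
      then have "?w \<in> R" using less.prems False by (intro less.hyps) auto
      then have "?x ?w \<in> R" by (rule RS)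
      then show ?thesis by (simp add: three_leg_pred_tour[OF st])
    qed (use R0 in simp)
  qed
  have "1 \<in> R" using down[of 1] st by simp
  from RS[OF this] have s: "s \<in> R" by (simp add: three_leg_tour_def)
  from RS[OF this] have t: "t \<in> R" using st by (simp add: three_leg_tour_def)
  show "\<exists>k. (?x ^^ k) n = u" if "u \<in> {1..n}" for u
    using down[of u] s t that unfolding R_def by auto
qed

text \<open>Cities \<open>s\<close> and \<open>t\<close> have a larger successor and every other
  city below \<open>n\<close> has a larger predecessor, so \<open>n\<close> is the only peak;
  nothing exceeds \<open>n\<close>, so it is no step-back peak.\<close>

lemma psb_three_leg_tour:
  assumes st: "2 \<le> s" "s + 2 \<le> t" "t < n"
  shows "psb_tour n (three_leg_tour n s t)"
proof -
  let ?x = "three_leg_tour n s t"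
  have h: "hamiltonian_tour n ?x" by (rule hamiltonian_three_leg_tour[OF st])
  have below: "\<not> peak ?x u" if "u \<in> {1..n}" "u \<noteq> n" for u
    using that st unfolding peak_def inv_three_leg_tour[OF st]
    by (auto simp: three_leg_tour_def three_leg_pred_def split: if_splits)
  have top: "peak ?x n"
    using st unfolding peak_def inv_three_leg_tour[OF st]
    by (auto simp: three_leg_tour_def three_leg_pred_def)
  have "\<not> step_back_peak ?x n"
  proof -
    have "(?x ^^ 2) n \<in> {1..n}" "(inv ?x ^^ 2) n \<in> {1..n}"
      using hamiltonian_tour_funpow_in[OF h, of n 2]
        hamiltonian_tour_funpow_in[OF hamiltonian_tour_inv[OF h], of n 2] st by simp_all
    then show ?thesis unfolding step_back_peak_def by auto
  qed
  with top below have "proper_peak ?x u \<longleftrightarrow> u = n" if "u \<in> {1..n}" for u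
    using that unfolding proper_peak_def by metis
  with h st show ?thesis by (simp add: psb_tour_iff)
qed

text \<open>
  The permutation taking \<open>u\<close> to the \<open>w\<close> with \<open>y w = x u\<close> is a single cycle on the cities
  where \<open>x\<close> and \<open>y\<close> differ, and an injective choice between \<open>x\<close> and \<open>y\<close> is constant along it.
\<close>

lemma three_leg_tour_choice:
  fixes n s t s' t' :: nat
  defines "x \<equiv> three_leg_tour n s t" and "y \<equiv> three_leg_tour n s' t'"
  assumes s: "2 \<le> s" "2 \<le> s'" "s = s' \<or> s + 2 \<le> s' \<or> s' + 2 \<le> s"
    and t: "t < n" "t' < n" "t = t' \<or> t + 2 \<le> t' \<or> t' + 2 \<le> t"
    and st: "s + 2 \<le> t" "s + 2 \<le> t'" "s' + 2 \<le> t" "s' + 2 \<le> t'"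
    and inj: "inj z" and z: "\<And>u. z u = x u \<or> z u = y u"
    and start: "s \<noteq> s' \<and> z 1 = x 1 \<or> s = s' \<and> z s = x s"
  shows "z = x"
proof -
  \<comment> \<open>If \<open>z\<close> followed \<open>y\<close> at \<open>w\<close>, it would take
    the value \<open>x u\<close> both at \<open>u\<close> and at \<open>w\<close>; when
    \<open>u = w\<close> the claim is immediate.\<close>
  have next': "z w = x w" if "z u = x u" "y w = x u" for u w
    using z[of w] that inj by (metis injD)
  have same: "z u = x u" if "x u = y u" for u
    using z[of u] that by auto
  \<comment> \<open>The cycle is \<open>1, s + 1, s, t + 1, t, t', t' + 1, s', s' + 1\<close>. For
    \<open>s = s'\<close> it starts at \<open>s\<close> and returns there after
    \<open>t' + 1\<close>; for \<open>t = t'\<close> it passes from \<open>s\<close> directly to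
    \<open>s'\<close>. Gaps of at least 2 keep the special cities of the two tours from
    interfering.\<close>
  have zs: "z s = x s \<and> (s \<noteq> s' \<longrightarrow> z (s + 1) = x (s + 1) \<and> z 1 = x 1)"
  proof (cases "s = s'")
    case True
    then show ?thesis using start by simp
  next
    case False
    then have z1: "z 1 = x 1" using start by simp
    have "y (s + 1) = x 1"
      using False s st t unfolding x_def y_def three_leg_tour_def by auto
    from next'[OF z1 this] have z2: "z (s + 1) = x (s + 1)" .
    have "y s = x (s + 1)"
      using False s st t unfolding x_def y_def three_leg_tour_def by auto
    from next'[OF z2 this] z1 z2 show ?thesis by simp
  qed
  then have zs1: "z s = x s" by simp
  have xs: "x s = t" using s unfolding x_def three_leg_tour_def by simp
  have ys': "y s' = t'" using s unfolding y_def three_leg_tour_def by simp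
  have zt: "(t \<noteq> t' \<longrightarrow> z (t + 1) = x (t + 1) \<and> z t = x t \<and> z t' = x t' \<and> z (t' + 1) = x (t' + 1))
    \<and> z s' = x s'"
  proof (cases "t = t'")
    case True
    then have "y s' = x s" using xs ys' by simp
    from next'[OF zs1 this] show ?thesis using True by simp
  next
    case False
    have "y (t + 1) = x s"
      using False s st t unfolding x_def y_def three_leg_tour_def by auto
    from next'[OF zs1 this] have z1: "z (t + 1) = x (t + 1)" .
    have "y t = x (t + 1)"
      using False s st t unfolding x_def y_def three_leg_tour_def by auto
    from next'[OF z1 this] have z2: "z t = x t" .
    have "y t' = x t"
      using False s st t unfolding x_def y_def three_leg_tour_def by auto
    from next'[OF z2 this] have z3: "z t' = x t'" .
    have "y (t' + 1) = x t'"
      using False s st t unfolding x_def y_def three_leg_tour_def by auto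
    from next'[OF z3 this] have z4: "z (t' + 1) = x (t' + 1)" .
    have "y s' = x (t' + 1)"
      using False s st t unfolding x_def y_def three_leg_tour_def by auto
    from next'[OF z4 this] z1 z2 z3 z4 show ?thesis by simp
  qed
  have zs'': "s \<noteq> s' \<longrightarrow> z (s' + 1) = x (s' + 1)"
  proof
    assume "s \<noteq> s'"
    then have "y (s' + 1) = x s'"
      using s st t unfolding x_def y_def three_leg_tour_def by auto
    with next' zt show "z (s' + 1) = x (s' + 1)" by blast
  qed
  have outside: "x u = y u"
    if "s = s' \<or> u \<notin> {1, s, s + 1, s', s' + 1}" "t = t' \<or> u \<notin> {s, s', t, t + 1, t', t' + 1}" for u
    using that unfolding x_def y_def three_leg_tour_def by (elim disjE) simp_all
  show "z = x"
  proof
    fix u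
    show "z u = x u"
    proof (cases "(s = s' \<or> u \<notin> {1, s, s + 1, s', s' + 1}) \<and>
        (t = t' \<or> u \<notin> {s, s', t, t + 1, t', t' + 1})")
      case True
      then show ?thesis using same[OF outside] by blast
    next
      case False
      then consider "s \<noteq> s'" "u \<in> {1, s, s + 1, s', s' + 1}"
        | "t \<noteq> t'" "u \<in> {s, s', t, t + 1, t', t' + 1}" by blast
      then show ?thesis using zs zt zs'' by cases (elim insertE; simp)+
    qed
  qed
qed

section \<open>A clique of quadratic size\<close>

lemma three_leg_tours_adjacent:
  assumes s: "2 \<le> s" "2 \<le> s'" "s = s' \<or> s + 2 \<le> s' \<or> s' + 2 \<le> s"
    and t: "t < n" "t' < n" "t = t' \<or> t + 2 \<le> t' \<or> t' + 2 \<le> t"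
    and st: "s + 2 \<le> t" "s + 2 \<le> t'" "s' + 2 \<le> t" "s' + 2 \<le> t'"
    and ne: "three_leg_tour n s t \<noteq> three_leg_tour n s' t'"
  shows "adjacent (PSB n) (char_vec n (three_leg_tour n s t)) (char_vec n (three_leg_tour n s' t'))"
proof (rule adjacentI_arcs)
  show "2 \<le> n" using s t st by simp
  show "psb_tour n (three_leg_tour n s t)" "psb_tour n (three_leg_tour n s' t')"
    using psb_three_leg_tour s t st by blast+
  fix z assume z: "psb_tour n z" "\<And>u. z u = three_leg_tour n s t u \<or> z u = three_leg_tour n s' t' u"
  have inj: "inj z"
    using z(1) psb_tour_hamiltonian hamiltonian_tour_bij bij_is_inj by blast
  \<comment> \<open>At the start of the cycle, \<open>1\<close> or \<open>s\<close>, the tour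
    \<open>z\<close> follows one of the two tours, and this choice propagates; the argument is
    applied in both orders.\<close>
  have "z = three_leg_tour n s t"
    if "s \<noteq> s' \<and> z 1 = three_leg_tour n s t 1 \<or> s = s' \<and> z s = three_leg_tour n s t s"
    using s t st inj z(2) that by (rule three_leg_tour_choice)
  moreover have "z = three_leg_tour n s' t'"
    if "s' \<noteq> s \<and> z 1 = three_leg_tour n s' t' 1 \<or> s' = s \<and> z s' = three_leg_tour n s' t' s'"
    by (rule three_leg_tour_choice[of s' s t' n t z]) (use s t st inj z(2) that in blast)+
  ultimately show "z = three_leg_tour n s t \<or> z = three_leg_tour n s' t'"
    using z(2) by metis
qed (rule ne)

lemma clique_number_PSB_ge:
  assumes k: "4 * k < n"
  shows "k ^ 2 \<le> clique_number (PSB n)"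
proof -
  \<comment> \<open>Doubling \<open>p\<close> and \<open>q\<close> gives gaps of at least 2 between
    distinct values, the ranges give \<open>s \<le> 2 * k\<close> and
    \<open>2 * k + 2 \<le> t\<close> for every pair, and \<open>t \<le> 4 * k < n\<close>.\<close>
  define P where "P = {1..k} \<times> {k + 1..2 * k}"
  define f where "f = (\<lambda>(p, q). three_leg_tour n (2 * p) (2 * q))"
  have f: "psb_tour n (f c)" if "c \<in> P" for c
    using that k unfolding P_def f_def by (auto intro!: psb_three_leg_tour)
  have f1: "f (p, q) 1 = 2 * p" and f2: "f (p, q) (2 * p) = 2 * q" for p q
    by (simp_all add: f_def three_leg_tour_def)
  have "inj_on f P"
  proof (rule inj_onI)
    fix c c' assume "f c = f c'"
    then show "c = c'" using f1 f2 by (cases c; cases c') (metis mult_cancel1 zero_neq_numeral)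
  qed
  have v: "inj_on (char_vec n) (f ` P)"
  proof (rule inj_onI)
    fix x y assume xy: "x \<in> f ` P" "y \<in> f ` P" "char_vec n x = char_vec n y"
    then have "hamiltonian_tour n x" "hamiltonian_tour n y"
      using f psb_tour_hamiltonian by auto
    moreover have "2 \<le> n" using xy(1) k by (auto simp: P_def)
    ultimately show "x = y" using char_vec_inject xy(3) by blast
  qed
  let ?C = "char_vec n ` f ` P"
  have "card ?C = k ^ 2"
    using v \<open>inj_on f P\<close> by (simp add: card_image P_def card_cartesian_product power2_eq_square)
  moreover have "?C \<subseteq> vertices (PSB n)"
  proof
    fix v assume "v \<in> ?C"
    then obtain c where c: "c \<in> P" "v = char_vec n (f c)" by blast
    then have "2 \<le> n" using k by (auto simp: P_def)
    with c f show "v \<in> vertices (PSB n)" using char_vec_vertex by blast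
  qed
  moreover have "pairwise (adjacent (PSB n)) ?C"
  proof (rule pairwiseI)
    fix v w assume "v \<in> ?C" "w \<in> ?C" and ne: "v \<noteq> w"
    then obtain p q p' q' where pq: "(p, q) \<in> P" "(p', q') \<in> P"
      and vw: "v = char_vec n (f (p, q))" "w = char_vec n (f (p', q'))" by auto
    show "adjacent (PSB n) v w"
      unfolding vw f_def prod.case
      by (rule three_leg_tours_adjacent) (use pq k ne in \<open>auto simp: P_def vw f_def\<close>)
  qed
  moreover have "finite {C. C \<subseteq> vertices (PSB n) \<and> pairwise (adjacent (PSB n)) C}"
    using finite_vertices_PSB[of n] by simp
  ultimately show ?thesis
    unfolding clique_number_def by (intro Max_ge) (auto simp: image_iff intro!: exI[of _ ?C])
qed

theorem theorem4:
  shows "\<exists>c1 c2 :: real. \<exists>n0 :: nat. c1 > 0 \<and> c2 > 0 \<and>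
    (\<forall>n \<ge> n0. c1 * real n ^ 2 \<le> real (clique_number (PSB n)) \<and>
              real (clique_number (PSB n)) \<le> c2 * real n ^ 2)"
proof (intro exI conjI allI impI)
  show "0 < (1 / 64 :: real)" "0 < (16 :: real)" by simp_all
  fix n :: nat assume n: "8 \<le> n"
  \<comment> \<open>The largest \<open>k\<close> with \<open>4 * k < n\<close>. Then
    \<open>n \<le> 4 * k + 4 \<le> 8 * k\<close> since \<open>k \<ge> 1\<close>, whence the constant
    \<open>1 / 64\<close>.\<close>
  let ?k = "(n - 1) div 4"
  have "n \<le> 8 * ?k" using n by presburger
  then have "n ^ 2 \<le> (8 * ?k) ^ 2" by (rule power_mono) simp
  also have "\<dots> = 64 * ?k ^ 2" by (simp add: power_mult_distrib)
  also have "?k ^ 2 \<le> clique_number (PSB n)"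
    using n by (intro clique_number_PSB_ge) presburger
  finally have "real (n ^ 2) \<le> real (64 * clique_number (PSB n))" by (simp only: of_nat_le_iff)
  then show "1 / 64 * real n ^ 2 \<le> real (clique_number (PSB n))" by simp
  have "real (clique_number (PSB n)) \<le> real (16 * n ^ 2)"
    using clique_number_PSB_le[of n] n by (simp only: of_nat_le_iff)
  then show "real (clique_number (PSB n)) \<le> 16 * real n ^ 2" by simp
qed

end
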